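(* There exist constants $K'>K>0$ such that for every open set $U\subset\mathbb{D}$ containing $0$ the following holds. Let $r$ be the conformal radius of $U$ at $0$ (defined via the universal covering), let $$A=\bigcup_{w\in\mathbb{C},\ e^{w}\in\mathbb{D}\setminus U}T(w),$$ and let $a=\frac{1}{2\pi}\operatorname{area}(A)$, where the area is that of the image of $A$ in the quotient cylinder $\mathbb{C}/2\pi i\mathbb{Z}$. Then $$-K' a\ \le\ \ln r\ \le\ -K a .$$
   Context: $\mathbb{D}$ is the open unit disc of $\mathbb{C}$. For an open set $U\subset\mathbb{D}$ containing $0$, the conformal radius of $U$ at $0$ is $r=|\phi'(0)|$, where $\phi:(\mathbb{D},0)\to(U,0)$ is a holomorphic universal covering of $U$ (of its connected component containing $0$) with $\phi(0)=0$. For $w_0\in\mathbb{C}$ with $\operatorname{Re}(w_0)<0$, $T(w_0)$ is the closed right isosceles triangle $T(w_0)=\{w_0\}\cup\{w\in\mathbb{C}: \operatorname{Re}(w)\le 0,\ w\ne w_0,\ |\operatorname{Arg}(w-w_0)|\le \pi/4\}$, whose right-angle vertex is $w_0$ and whose hypotenuse lies on the imaginary axis. The cylinder $\mathbb{C}/2\pi i\mathbb{Z}$ carries the area measure induced from Lebesgue measure on $\mathbb{C}$. *)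

theory Defs
  imports "HOL-Complex_Analysis.Complex_Analysis"
begin

(* The disc is simply connected, so every covering by it is universal. *)
definition disc_universal_covering :: "complex set \<Rightarrow> (complex \<Rightarrow> complex) \<Rightarrow> bool" where
  "disc_universal_covering V \<phi> \<longleftrightarrow>
     \<phi> holomorphic_on ball 0 1 \<and> covering_space (ball 0 1) \<phi> V"

(* A relation rather than a function: existence and uniqueness of r are the uniformization theorem
   and the lifting property together with the Schwarz lemma. *)
definition has_conformal_radius :: "complex set \<Rightarrow> real \<Rightarrow> bool" where
  "has_conformal_radius U r \<longleftrightarrow>
     (\<exists>\<phi>. disc_universal_covering (connected_component_set U 0) \<phi> \<and> \<phi> 0 = 0 \<and>
          r = cmod (deriv \<phi> 0))"

definition triangle :: "complex \<Rightarrow> complex set" where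
  "triangle w0 = {w0} \<union> {w. Re w \<le> 0 \<and> w \<noteq> w0 \<and> \<bar>Arg (w - w0)\<bar> \<le> pi / 4}"

definition triangle_union :: "complex set \<Rightarrow> complex set" where
  "triangle_union U = (\<Union>w\<in>{w. exp w \<in> ball 0 1 - U}. triangle w)"

(* The point of the cylinder represented by w, as a coset of the lattice. *)
definition cyl_proj :: "complex \<Rightarrow> complex set" where
  "cyl_proj w = range (\<lambda>k::int. w + 2 * of_real pi * \<i> * of_int k)"

(* Area of a set of cosets, computed on a fundamental strip. *)
definition cyl_area :: "complex set set \<Rightarrow> real" where
  "cyl_area S = measure lebesgue {w. 0 \<le> Im w \<and> Im w < 2 * pi \<and> cyl_proj w \<in> S}"

end

theory Submission
  imports Defs
begin

text \<open>
  Everything is compared with \<open>\<Sum> d\<^sub>i\<^sup>2\<close>, where the \<open>w\<^sub>i\<close> form a Vitali subfamily of the obstacles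
  (the points \<open>w\<close> with \<open>exp w\<close> in the disc but not in \<open>U\<close>),
  \<open>d\<^sub>i = - Re w\<^sub>i\<close>, and the discs of radius \<open>d\<^sub>i\<close> about \<open>\<i> Im w\<^sub>i\<close> are disjoint: the area of
  \<open>A\<close> in the cylinder is comparable with this sum.

  Upper bound. Let \<open>f\<close> map the disc into itself, fix \<open>0\<close> and omit the points \<open>p\<^sub>i = exp w\<^sub>i\<close>. With
  \<open>Y\<^sub>i\<close> the function \<open>1 - |B\<^sub>i|\<^sup>2\<close> for the Blaschke factor \<open>B\<^sub>i\<close> of \<open>p\<^sub>i\<close> and
  \<open>v = c \<Sum> (Y\<^sub>i\<^sup>2 + 2 Y\<^sub>i\<^sup>3)\<close>, the function
  \<open>E = exp (v \<circ> f) (1 - |z|\<^sup>2) |f'| / (1 - |f|\<^sup>2)\<close> is at most \<open>1\<close> by the maximum principle, as in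
  Ahlfors' lemma. Away from the \<open>p\<^sub>i\<close> this is a computation of Laplacians; near \<open>p\<^sub>i\<close> the square
  root of \<open>B\<^sub>i \<circ> f\<close> improves the Schwarz-Pick inequality by a definite factor. Disjointness gives a
  uniform bound for \<open>\<Sum> Y\<^sub>i\<close> by comparison with the Poisson integral of \<open>1\<close>. At \<open>0\<close> one obtains
  \<open>ln |f' 0| \<le> - c \<Sum> d\<^sub>i\<^sup>2\<close>.

  Lower bound. The complement of the triangles exponentiates to a starlike domain inside \<open>U\<close>, whose
  Riemann map lifts to the universal covering. The harmonic function
  \<open>180 \<Sum> d\<^sub>i\<^sup>2 Re (1 / (1 + d\<^sub>i - w cnj \<zeta>\<^sub>i))\<close>, \<open>\<zeta>\<^sub>i = exp (\<i> Im w\<^sub>i)\<close>, dominates \<open>- ln |w|\<close>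
  outside that domain and is at most \<open>180 \<Sum> d\<^sub>i\<^sup>2\<close> at \<open>0\<close>.

  If some \<open>d\<close> exceeds \<open>1\<close>, the deepest obstacle alone gives both bounds.
\<close>

subsection \<open>Laplacians at local maxima\<close>

text \<open>A relation at a single point that asks only for the two second derivatives along the
  axes through \<open>z\<close>. The second derivative test at a maximum needs no more, so no joint
  smoothness has to be carried along.\<close>

definition has_laplacian :: "(complex \<Rightarrow> real) \<Rightarrow> real \<Rightarrow> complex \<Rightarrow> bool" where
  "has_laplacian f L z \<longleftrightarrow> (\<exists>f1 f2 a b.
     (\<forall>\<^sub>F t in nhds 0. ((\<lambda>t. f (z + of_real t)) has_real_derivative f1 t) (at t)) \<and>
     (f1 has_real_derivative a) (at 0) \<and>
     (\<forall>\<^sub>F t in nhds 0. ((\<lambda>t. f (z + \<i> * of_real t)) has_real_derivative f2 t) (at t)) \<and>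
     (f2 has_real_derivative b) (at 0) \<and> L = a + b)"

lemma has_laplacian_const: "has_laplacian (\<lambda>_. c) 0 z"
  unfolding has_laplacian_def
  by (intro exI[of _ "\<lambda>_. 0"] exI[of _ 0]) auto

lemma has_laplacian_add:
  assumes "has_laplacian f L z" "has_laplacian g M z"
  shows "has_laplacian (\<lambda>w. f w + g w) (L + M) z"
proof -
  from assms(1) obtain f1 f2 a b where f:
     "\<forall>\<^sub>F t in nhds 0. ((\<lambda>t. f (z + of_real t)) has_real_derivative f1 t) (at t)"
     "(f1 has_real_derivative a) (at 0)"
     "\<forall>\<^sub>F t in nhds 0. ((\<lambda>t. f (z + \<i> * of_real t)) has_real_derivative f2 t) (at t)"
     "(f2 has_real_derivative b) (at 0)" "L = a + b"
    unfolding has_laplacian_def by blast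
  from assms(2) obtain g1 g2 c d where g:
     "\<forall>\<^sub>F t in nhds 0. ((\<lambda>t. g (z + of_real t)) has_real_derivative g1 t) (at t)"
     "(g1 has_real_derivative c) (at 0)"
     "\<forall>\<^sub>F t in nhds 0. ((\<lambda>t. g (z + \<i> * of_real t)) has_real_derivative g2 t) (at t)"
     "(g2 has_real_derivative d) (at 0)" "M = c + d"
    unfolding has_laplacian_def by blast
  show ?thesis
    unfolding has_laplacian_def
  proof (intro exI conjI)
    show "\<forall>\<^sub>F t in nhds 0. ((\<lambda>t. f (z + of_real t) + g (z + of_real t)) has_real_derivative f1 t + g1 t) (at t)"
      using f(1) g(1) by eventually_elim (auto intro: DERIV_add)
    show "\<forall>\<^sub>F t in nhds 0. ((\<lambda>t. f (z + \<i> * of_real t) + g (z + \<i> * of_real t)) has_real_derivative f2 t + g2 t) (at t)"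
      using f(3) g(3) by eventually_elim (auto intro: DERIV_add)
    show "((\<lambda>t. f1 t + g1 t) has_real_derivative a + c) (at 0)"
      using f(2) g(2) by (rule DERIV_add)
    show "((\<lambda>t. f2 t + g2 t) has_real_derivative b + d) (at 0)"
      using f(4) g(4) by (rule DERIV_add)
    show "L + M = (a + c) + (b + d)" using f(5) g(5) by simp
  qed
qed

lemma has_laplacian_cmult:
  assumes "has_laplacian f L z"
  shows "has_laplacian (\<lambda>w. c * f w) (c * L) z"
proof -
  from assms(1) obtain f1 f2 a b where f:
     "\<forall>\<^sub>F t in nhds 0. ((\<lambda>t. f (z + of_real t)) has_real_derivative f1 t) (at t)"
     "(f1 has_real_derivative a) (at 0)"
     "\<forall>\<^sub>F t in nhds 0. ((\<lambda>t. f (z + \<i> * of_real t)) has_real_derivative f2 t) (at t)"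
     "(f2 has_real_derivative b) (at 0)" "L = a + b"
    unfolding has_laplacian_def by blast
  show ?thesis
    unfolding has_laplacian_def
  proof (intro exI conjI)
    show "\<forall>\<^sub>F t in nhds 0. ((\<lambda>t. c * f (z + of_real t)) has_real_derivative c * f1 t) (at t)"
      using f(1) by eventually_elim (rule DERIV_cmult)
    show "\<forall>\<^sub>F t in nhds 0. ((\<lambda>t. c * f (z + \<i> * of_real t)) has_real_derivative c * f2 t) (at t)"
      using f(3) by eventually_elim (rule DERIV_cmult)
    show "((\<lambda>t. c * f1 t) has_real_derivative c * a) (at 0)"
      using f(2) by (rule DERIV_cmult)
    show "((\<lambda>t. c * f2 t) has_real_derivative c * b) (at 0)"
      using f(4) by (rule DERIV_cmult)
    show "c * L = c * a + c * b" using f(5) by (simp add: algebra_simps)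
  qed
qed

lemma has_laplacian_sum:
  assumes "\<And>i. i \<in> I \<Longrightarrow> has_laplacian (f i) (L i) z"
  shows "has_laplacian (\<lambda>w. \<Sum>i\<in>I. f i w) (\<Sum>i\<in>I. L i) z"
  using assms
proof (induction I rule: infinite_finite_induct)
  case (insert i I)
  then show ?case using has_laplacian_add[of "f i" "L i" z] by simp
qed (auto simp: has_laplacian_const)

text \<open>If \<open>a\<close> were positive, then \<open>F1\<close>, which vanishes at the
  maximum, would be positive just to the right of 0, and the mean value theorem would push
  \<open>F\<close> above \<open>F 0\<close> there.\<close>

lemma second_derivative_local_max:
  fixes F F1 :: "real \<Rightarrow> real"
  assumes d1: "\<forall>\<^sub>F t in nhds 0. (F has_real_derivative F1 t) (at t)"
      and d2: "(F1 has_real_derivative a) (at 0)"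
      and mx: "\<forall>\<^sub>F t in nhds 0. F t \<le> F 0"
  shows "a \<le> 0"
proof (rule ccontr)
  assume "\<not> a \<le> 0"
  then have "a > 0" by simp
  obtain e1 where e1: "e1 > 0" "\<And>t. \<bar>t\<bar> < e1 \<Longrightarrow> (F has_real_derivative F1 t) (at t)"
    using d1 unfolding eventually_nhds_metric by (auto simp: dist_real_def)
  obtain e2 where e2: "e2 > 0" "\<And>t. \<bar>t\<bar> < e2 \<Longrightarrow> F t \<le> F 0"
    using mx unfolding eventually_nhds_metric by (auto simp: dist_real_def)
  have F10: "F1 0 = 0"
    by (rule DERIV_local_max[OF e1(2)[of 0] e2(1)]) (use e1 e2 in auto)
  obtain e3 where e3: "e3 > 0" "\<And>h. 0 < h \<Longrightarrow> h < e3 \<Longrightarrow> F1 0 < F1 (0 + h)"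
    using DERIV_pos_inc_right[OF d2 \<open>a > 0\<close>] by blast
  define t where "t = min e1 (min e2 e3) / 2"
  have t: "0 < t" "t < e1" "t < e2" "t < e3"
    using e1(1) e2(1) e3(1) by (auto simp: t_def)
  obtain s where s: "0 < s" "s < t" "F t - F 0 = (t - 0) * F1 s"
    using MVT2[of 0 t F F1] e1(2) t by force
  have "F1 s > 0" using e3(2)[of s] s t F10 by simp
  then have "F t > F 0" using s t by (simp add: algebra_simps)
  with e2(2)[of t] t show False by simp
qed

lemma has_laplacian_local_max:
  assumes "has_laplacian f L z" and mx: "\<forall>\<^sub>F w in nhds z. f w \<le> f z"
  shows "L \<le> 0"
proof -
  from assms(1) obtain f1 f2 a b where f:
     "\<forall>\<^sub>F t in nhds 0. ((\<lambda>t. f (z + of_real t)) has_real_derivative f1 t) (at t)"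
     "(f1 has_real_derivative a) (at 0)"
     "\<forall>\<^sub>F t in nhds 0. ((\<lambda>t. f (z + \<i> * of_real t)) has_real_derivative f2 t) (at t)"
     "(f2 has_real_derivative b) (at 0)" "L = a + b"
    unfolding has_laplacian_def by blast
  have "((\<lambda>t::real. z + of_real t) \<longlongrightarrow> z + of_real 0) (nhds 0)"
       "((\<lambda>t::real. z + \<i> * of_real t) \<longlongrightarrow> z + \<i> * of_real 0) (nhds 0)"
    by (intro tendsto_intros filterlim_ident)+
  then have "\<forall>\<^sub>F t in nhds 0. f (z + of_real t) \<le> f (z + of_real 0)"
            "\<forall>\<^sub>F t in nhds 0. f (z + \<i> * of_real t) \<le> f (z + \<i> * of_real 0)"
    using mx by (auto simp: filterlim_iff)
  from second_derivative_local_max[OF f(1,2) this(1)] second_derivative_local_max[OF f(3,4) this(2)]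
  show ?thesis using f(5) by simp
qed

lemma norm_power2_along_line:
  fixes g :: "complex \<Rightarrow> complex"
  assumes "(g has_field_derivative g') (at (z + e * of_real t))"
  shows "((\<lambda>t. (cmod (g (z + e * of_real t)))\<^sup>2) has_real_derivative
           2 * Re (cnj (g (z + e * of_real t)) * (g' * e))) (at t)"
proof -
  have "((\<lambda>t. g (z + e * of_real t)) has_vector_derivative (e * g')) (at t)"
    by (rule field_vector_diff_chain_at[of "\<lambda>t. z + e * of_real t" e t g g', unfolded o_def])
       (auto intro!: derivative_eq_intros assms simp: has_vector_derivative_def scaleR_conv_of_real)
  then have "((\<lambda>t. Re (g (z + e * of_real t))) has_real_derivative Re (e * g')) (at t)"
            "((\<lambda>t. Im (g (z + e * of_real t))) has_real_derivative Im (e * g')) (at t)"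
    by (simp_all add: has_vector_derivative_complex_iff has_real_derivative_iff_has_vector_derivative)
  from DERIV_add[OF DERIV_power[OF this(1), of 2] DERIV_power[OF this(2), of 2]] show ?thesis
    unfolding cmod_power2
    by (rule DERIV_cong) (simp add: algebra_simps)
qed

text \<open>In the direction \<open>e\<close> the second derivative of \<open>g\<close> enters only
  with the factor \<open>e\<^sup>2\<close>, so its contributions for \<open>e = 1\<close> and
  \<open>e = \<i>\<close> cancel. The remaining terms give \<open>4 |g'|\<^sup>2\<close> times the
  derivative of \<open>x \<psi>1 x\<close> at \<open>x = |g|\<^sup>2\<close>.\<close>

lemma has_laplacian_compose_norm_power2:
  fixes g :: "complex \<Rightarrow> complex" and \<psi> \<psi>1 :: "real \<Rightarrow> real"
  assumes holg: "g holomorphic_on S" and S: "open S" "z \<in> S"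
    and d1: "\<forall>\<^sub>F x in nhds ((cmod (g z))\<^sup>2). (\<psi> has_real_derivative \<psi>1 x) (at x)"
    and d2: "(\<psi>1 has_real_derivative \<psi>2) (at ((cmod (g z))\<^sup>2))"
  shows "has_laplacian (\<lambda>w. \<psi> ((cmod (g w))\<^sup>2))
           (4 * (cmod (deriv g z))\<^sup>2 * (\<psi>1 ((cmod (g z))\<^sup>2) + (cmod (g z))\<^sup>2 * \<psi>2)) z"
proof -
  define N where "N = (\<lambda>e t. (cmod (g (z + e * of_real t)))\<^sup>2)"
  define M where "M = (\<lambda>e t. 2 * Re (cnj (g (z + e * of_real t)) * (deriv g (z + e * of_real t) * e)))"
  have lim: "((\<lambda>t::real. z + e * of_real t) \<longlongrightarrow> z) (nhds 0)" for e
    by (rule tendsto_eq_intros filterlim_ident refl | simp)+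
  have evS: "\<forall>\<^sub>F t in nhds (0::real). z + e * of_real t \<in> S" for e
    using lim[of e] S by (rule topological_tendstoD)
  have dN: "(N e has_real_derivative M e t) (at t)" if "z + e * of_real t \<in> S" for e t
    unfolding N_def M_def using holomorphic_derivI[OF holg S(1) that]
    by (rule norm_power2_along_line)
  have N0: "N e 0 = (cmod (g z))\<^sup>2" for e by (simp add: N_def)
  have NL: "(N e \<longlongrightarrow> (cmod (g z))\<^sup>2) (nhds 0)" for e
    using dN[of e 0] S DERIV_isCont[of "N e" _ 0] N0[of e] 
    by (auto simp: isCont_def tendsto_def eventually_nhds_conv_at)
  have D1: "\<forall>\<^sub>F t in nhds 0. ((\<lambda>t. \<psi> (N e t)) has_real_derivative \<psi>1 (N e t) * M e t) (at t)" for e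
  proof -
    have "\<forall>\<^sub>F t in nhds 0. (\<psi> has_real_derivative \<psi>1 (N e t)) (at (N e t))"
      using NL[of e] d1 by (auto simp: filterlim_iff)
    then show ?thesis using evS[of e]
      by eventually_elim (rule DERIV_chain2, auto intro: dN)
  qed
  define G2 where "G2 = deriv (deriv g) z"
  have dM: "(M e has_real_derivative
       2 * ((cmod (deriv g z * e))\<^sup>2 + Re (cnj (g z) * (G2 * e * e)))) (at 0)" for e
  proof -
    have a: "((\<lambda>t. g (z + e * of_real t)) has_vector_derivative (e * deriv g z)) (at 0)"
      by (rule field_vector_diff_chain_at[of "\<lambda>t. z + e * of_real t" e 0 g "deriv g z", unfolded o_def])
         (auto intro!: derivative_eq_intros holomorphic_derivI[OF holg S] simp: has_vector_derivative_def scaleR_conv_of_real)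
    have b: "((\<lambda>t. deriv g (z + e * of_real t)) has_vector_derivative (e * G2)) (at 0)"
      unfolding G2_def
      by (rule field_vector_diff_chain_at[of "\<lambda>t. z + e * of_real t" e 0 "deriv g" "deriv (deriv g) z", unfolded o_def])
         (auto intro!: derivative_eq_intros holomorphic_derivI[OF holomorphic_deriv[OF holg S(1)] S] simp: has_vector_derivative_def scaleR_conv_of_real)
    have ab: "((\<lambda>t. Re (g (z + e * of_real t))) has_real_derivative Re (e * deriv g z)) (at 0)"
         "((\<lambda>t. Im (g (z + e * of_real t))) has_real_derivative Im (e * deriv g z)) (at 0)"
         "((\<lambda>t. Re (deriv g (z + e * of_real t))) has_real_derivative Re (e * G2)) (at 0)"
         "((\<lambda>t. Im (deriv g (z + e * of_real t))) has_real_derivative Im (e * G2)) (at 0)"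
      using a b by (simp_all add: has_vector_derivative_complex_iff has_real_derivative_iff_has_vector_derivative)
    have "M e = (\<lambda>t. 2 * (Re (g (z + e * of_real t)) * (Re (deriv g (z + e * of_real t)) * Re e - Im (deriv g (z + e * of_real t)) * Im e)
                 + Im (g (z + e * of_real t)) * (Re (deriv g (z + e * of_real t)) * Im e + Im (deriv g (z + e * of_real t)) * Re e)))"
      by (simp add: M_def fun_eq_iff algebra_simps)
    moreover have "(\<dots> has_real_derivative
       2 * ((cmod (deriv g z * e))\<^sup>2 + Re (cnj (g z) * (G2 * e * e)))) (at 0)"
      by (rule DERIV_cong[OF DERIV_cmult[OF DERIV_add[OF
            DERIV_mult[OF ab(1) DERIV_diff[OF DERIV_cmult_right[OF ab(3), of "Re e"] DERIV_cmult_right[OF ab(4), of "Im e"]]]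
            DERIV_mult[OF ab(2) DERIV_add[OF DERIV_cmult_right[OF ab(3), of "Im e"] DERIV_cmult_right[OF ab(4), of "Re e"]]]]]])
         (simp add: cmod_power2, simp add: algebra_simps power2_eq_square)
    ultimately show ?thesis by simp
  qed
  have D2: "((\<lambda>t. \<psi>1 (N e t) * M e t) has_real_derivative
      \<psi>2 * (M e 0)\<^sup>2 + \<psi>1 ((cmod (g z))\<^sup>2) * (2 * ((cmod (deriv g z * e))\<^sup>2 + Re (cnj (g z) * (G2 * e * e))))) (at 0)" for e
  proof -
    have "((\<lambda>t. \<psi>1 (N e t)) has_real_derivative \<psi>2 * M e 0) (at 0)"
      by (rule DERIV_chain2) (use d2 N0 dN[of e 0] S in auto)
    from DERIV_mult[OF this dM[of e]] show ?thesis
      by (simp add: N0 power2_eq_square algebra_simps)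
  qed
  show ?thesis
    unfolding has_laplacian_def
  proof (intro exI conjI)
    show "\<forall>\<^sub>F t in nhds 0. ((\<lambda>t. \<psi> ((cmod (g (z + of_real t)))\<^sup>2)) has_real_derivative \<psi>1 (N 1 t) * M 1 t) (at t)"
      using D1[of 1] by (simp add: N_def)
    show "\<forall>\<^sub>F t in nhds 0. ((\<lambda>t. \<psi> ((cmod (g (z + \<i> * of_real t)))\<^sup>2)) has_real_derivative \<psi>1 (N \<i> t) * M \<i> t) (at t)"
      using D1[of \<i>] by (simp add: N_def)
    show "4 * (cmod (deriv g z))\<^sup>2 * (\<psi>1 ((cmod (g z))\<^sup>2) + (cmod (g z))\<^sup>2 * \<psi>2) =
      (\<psi>2 * (M 1 0)\<^sup>2 + \<psi>1 ((cmod (g z))\<^sup>2) * (2 * ((cmod (deriv g z * 1))\<^sup>2 + Re (cnj (g z) * (G2 * 1 * 1))))) + 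
      (\<psi>2 * (M \<i> 0)\<^sup>2 + \<psi>1 ((cmod (g z))\<^sup>2) * (2 * ((cmod (deriv g z * \<i>))\<^sup>2 + Re (cnj (g z) * (G2 * \<i> * \<i>)))))"
      by (simp add: M_def cmod_power2 norm_mult) (simp add: algebra_simps power2_eq_square)
  qed (use D2[of 1] D2[of \<i>] in auto)
qed

subsection \<open>The Schwarz-Pick lemma and omitted values\<close>

text \<open>The function \<open>Y\<^sub>i\<close> of the overview: one minus the squared modulus of
  the Blaschke factor of \<open>p\<close>, and also \<open>1 - |w|\<^sup>2\<close> times the modulus
  of the derivative of that factor.\<close>

definition disc_kernel :: "complex \<Rightarrow> complex \<Rightarrow> real" where
  "disc_kernel p w = (1 - (cmod p)\<^sup>2) * (1 - (cmod w)\<^sup>2) / (cmod (1 - cnj p * w))\<^sup>2"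

lemma one_minus_cnj_mult_neq_0:
  assumes "cmod p < 1" "cmod w < 1"
  shows "1 - cnj p * w \<noteq> 0"
proof
  assume "1 - cnj p * w = 0"
  then have "cmod (cnj p * w) = 1" by (metis eq_iff_diff_eq_0 norm_one)
  then have "cmod p * cmod w = 1" by (simp add: norm_mult)
  moreover have "cmod p * cmod w < 1 * 1"
    by (rule mult_strict_mono') (use assms in auto)
  ultimately show False by simp
qed

lemma norm_power2_one_minus_cnj_mult:
  "(cmod (1 - cnj p * w))\<^sup>2 = (1 - (cmod p)\<^sup>2) * (1 - (cmod w)\<^sup>2) + (cmod (w - p))\<^sup>2"
  by (cases p; cases w) (simp add: cmod_power2, simp add: algebra_simps power2_eq_square)

lemma norm_Moebius_power2:
  assumes "cmod p < 1" "cmod w < 1"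
  shows "(cmod (Moebius_function 0 p w))\<^sup>2 = 1 - disc_kernel p w"
  using one_minus_cnj_mult_neq_0[OF assms] norm_power2_one_minus_cnj_mult[of p w]
  by (simp add: Moebius_function_simple disc_kernel_def norm_divide power_divide field_simps)

lemma disc_kernel_bounds:
  assumes "cmod p < 1" "cmod w < 1"
  shows "0 < disc_kernel p w" "disc_kernel p w \<le> 1"
proof -
  have "(cmod p)\<^sup>2 < 1" "(cmod w)\<^sup>2 < 1" using assms by (auto simp: abs_square_less_1)
  then show "0 < disc_kernel p w"
    using one_minus_cnj_mult_neq_0[OF assms] by (simp add: disc_kernel_def)
  show "disc_kernel p w \<le> 1"
    using norm_Moebius_power2[OF assms] zero_le_power2[of "cmod (Moebius_function 0 p w)"] by linarith
qed

lemma Moebius_has_field_derivative: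
  assumes "cmod p < 1" "cmod w < 1"
  shows "(Moebius_function 0 p has_field_derivative (1 - of_real ((cmod p)\<^sup>2)) / (1 - cnj p * w)\<^sup>2) (at w)"
proof -
  have "of_real ((cmod p)\<^sup>2) = p * cnj p" by (metis complex_norm_square)
  then show ?thesis
    using one_minus_cnj_mult_neq_0[OF assms]
    unfolding Moebius_function_simple[abs_def]
    by (auto intro!: derivative_eq_intros simp: field_simps power2_eq_square)
qed

lemma norm_deriv_Moebius_compose:
  assumes holf: "f holomorphic_on S" "open S" "z \<in> S" and "cmod p < 1" "cmod (f z) < 1"
  shows "(1 - (cmod (f z))\<^sup>2) * cmod (deriv (\<lambda>z. Moebius_function 0 p (f z)) z) = disc_kernel p (f z) * cmod (deriv f z)"
proof -
  have "((\<lambda>z. Moebius_function 0 p (f z)) has_field_derivative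
      (1 - of_real ((cmod p)\<^sup>2)) / (1 - cnj p * f z)\<^sup>2 * deriv f z) (at z)"
    by (rule DERIV_chain2[OF Moebius_has_field_derivative]) (use assms in \<open>auto intro: holomorphic_derivI\<close>)
  then have "deriv (\<lambda>z. Moebius_function 0 p (f z)) z = (1 - of_real ((cmod p)\<^sup>2)) / (1 - cnj p * f z)\<^sup>2 * deriv f z"
    by (rule DERIV_imp_deriv)
  moreover have "cmod (1 - of_real ((cmod p)\<^sup>2)) = 1 - (cmod p)\<^sup>2"
  proof -
    have "(cmod p)\<^sup>2 < 1" using assms by (auto simp: abs_square_less_1)
    moreover have "cmod (1 - of_real ((cmod p)\<^sup>2)) = \<bar>1 - (cmod p)\<^sup>2\<bar>"
      by (metis norm_of_real of_real_1 of_real_diff)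
    ultimately show ?thesis by simp
  qed
  ultimately show ?thesis
    by (simp add: disc_kernel_def norm_mult norm_divide norm_power)
qed

text \<open>Moebius maps move \<open>z\<close> and \<open>f z\<close> to 0, where the claim is the
  Schwarz lemma.\<close>

lemma Schwarz_Pick:
  assumes holf: "f holomorphic_on ball 0 1" and f1: "\<And>z. cmod z < 1 \<Longrightarrow> cmod (f z) < 1" and z: "cmod z < 1"
  shows "(1 - (cmod z)\<^sup>2) * cmod (deriv f z) \<le> 1 - (cmod (f z))\<^sup>2"
proof -
  define h where "h = (\<lambda>w. f (Moebius_function 0 (-z) w))"
  have M: "cmod (Moebius_function 0 (-z) w) < 1" if "cmod w < 1" for w
    using Moebius_function_norm_lt_1 that z by simp
  have Mz: "Moebius_function 0 (-z) 0 = z"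
    by (simp add: Moebius_function_simple)
  have dh: "(h has_field_derivative deriv f z * (1 - of_real ((cmod z)\<^sup>2))) (at 0)"
    unfolding h_def
    using Moebius_has_field_derivative[of "-z" 0] z holf Mz
    by (intro DERIV_chain2[where g = "Moebius_function 0 (-z)"]) (auto intro!: holomorphic_derivI)
  have holh: "h holomorphic_on ball 0 1"
    unfolding h_def using M
    by (intro holomorphic_on_compose_gen[OF Moebius_function_holomorphic holf, unfolded o_def])
       (use z in auto)
  define g where "g = (\<lambda>w. Moebius_function 0 (f z) (h w))"
  have h0: "h 0 = f z" by (simp add: h_def Mz)
  have h1: "cmod (h w) < 1" if "cmod w < 1" for w
    using f1 M that by (simp add: h_def)
  have "cmod (deriv g 0) \<le> 1"
  proof (rule Schwarz_Lemma(2)[where \<xi> = 0])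
    show "g holomorphic_on ball 0 1"
      unfolding g_def
      by (intro holomorphic_on_compose_gen[OF holh Moebius_function_holomorphic, unfolded o_def])
         (use z f1 h1 in auto)
    show "g 0 = 0" by (simp add: g_def h0 Moebius_function_eq_zero)
    show "cmod (g w) < 1" if "cmod w < 1" for w
      unfolding g_def using Moebius_function_norm_lt_1 f1 z h1 that by blast
  qed (auto)
  moreover have "(1 - (cmod (h 0))\<^sup>2) * cmod (deriv g 0) = disc_kernel (f z) (h 0) * cmod (deriv h 0)"
    unfolding g_def by (rule norm_deriv_Moebius_compose[OF holh]) (use f1 z h1 in auto)
  moreover have "disc_kernel (f z) (h 0) = 1"
    using norm_Moebius_power2[of "f z" "f z"] f1[OF z] by (simp add: h0 Moebius_function_eq_zero)
  moreover have "deriv h 0 = deriv f z * (1 - of_real ((cmod z)\<^sup>2))"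
    using dh by (rule DERIV_imp_deriv)
  moreover have "cmod (1 - of_real ((cmod z)\<^sup>2)) = 1 - (cmod z)\<^sup>2"
  proof -
    have "(cmod z)\<^sup>2 < 1" using z by (auto simp: abs_square_less_1)
    moreover have "cmod (1 - of_real ((cmod z)\<^sup>2)) = \<bar>1 - (cmod z)\<^sup>2\<bar>"
      by (metis norm_of_real of_real_1 of_real_diff)
    ultimately show ?thesis by simp
  qed
  moreover have "(cmod (f z))\<^sup>2 < 1" using f1[OF z] by (auto simp: abs_square_less_1)
  ultimately show ?thesis
    using mult_left_mono[of "cmod (deriv g 0)" 1 "1 - (cmod (f z))\<^sup>2"]
    by (simp add: h0 norm_mult mult.commute)
qed

text \<open>Since \<open>f\<close> omits \<open>p\<close>, the Blaschke factor composed with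
  \<open>f\<close> has no zero and hence a holomorphic square root \<open>s\<close> on the disc. The
  Schwarz-Pick lemma for \<open>s\<close>, where \<open>|s z|\<^sup>2 = b\<close>, improves the one
  for \<open>f\<close> by the factor \<open>2 sqrt b / (1 + b) < 1\<close>.\<close>

lemma Schwarz_Pick_omitted_value:
  assumes holf: "f holomorphic_on ball 0 1" and f1: "\<And>z. cmod z < 1 \<Longrightarrow> cmod (f z) < 1" and z: "cmod z < 1"
    and p: "cmod p < 1" "\<And>z. cmod z < 1 \<Longrightarrow> f z \<noteq> p"
    and b: "b = cmod (Moebius_function 0 p (f z))"
  shows "(1 - (cmod z)\<^sup>2) * cmod (deriv f z) * (1 + b) \<le> 2 * sqrt b * (1 - (cmod (f z))\<^sup>2)"
proof -
  define g where "g = (\<lambda>z. Moebius_function 0 p (f z))"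
  have holg: "g holomorphic_on ball 0 1"
    unfolding g_def using p f1
    by (intro holomorphic_on_compose_gen[OF holf Moebius_function_holomorphic, unfolded o_def]) auto
  have g0: "g z \<noteq> 0" if "z \<in> ball 0 1" for z
    using one_minus_cnj_mult_neq_0[of p "f z"] p f1 that by (auto simp: g_def Moebius_function_simple)
  obtain s where hols: "s holomorphic_on ball 0 1" and s: "\<And>z. z \<in> ball 0 1 \<Longrightarrow> g z = s z ^ 2"
    using contractible_imp_holomorphic_sqrt[OF holg _ g0] convex_imp_contractible[of "ball 0 (1::real)"]
    by (metis convex_ball convex_imp_contractible)
  have g1: "cmod (g z) < 1" if "cmod z < 1" for z
    unfolding g_def using Moebius_function_norm_lt_1 f1 p that by blast
  have s1: "cmod (s z) < 1" if "cmod z < 1" for z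
    using s[of z] g1[of z] that by (simp add: norm_power abs_square_less_1)
  have SP: "(1 - (cmod z)\<^sup>2) * cmod (deriv s z) \<le> 1 - (cmod (s z))\<^sup>2"
    by (rule Schwarz_Pick[OF hols s1 z])
  have bs: "(cmod (s z))\<^sup>2 = b" using s[of z] z b by (simp add: g_def norm_power)
  then have sb: "cmod (s z) = sqrt b" using real_sqrt_unique by fastforce
  have "(g has_field_derivative 2 * s z * deriv s z) (at z)"
  proof (rule has_field_derivative_transform_within_open[of "\<lambda>z. s z ^ 2" _ _ "ball 0 1"])
    show "((\<lambda>z. (s z)\<^sup>2) has_field_derivative 2 * s z * deriv s z) (at z)"
      using z by (auto intro!: derivative_eq_intros holomorphic_derivI[OF hols])
  qed (use z s in auto)
  then have dg: "deriv g z = 2 * s z * deriv s z" by (rule DERIV_imp_deriv)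
  have b1: "0 \<le> b" "b < 1" using g1[OF z] b by (auto simp: g_def)
  have k: "disc_kernel p (f z) = 1 - b\<^sup>2"
    using norm_Moebius_power2[OF p(1) f1[OF z]] b by simp
  have "(1 - (cmod (f z))\<^sup>2) * cmod (deriv g z) = (1 - b\<^sup>2) * cmod (deriv f z)"
    unfolding g_def k[symmetric] by (rule norm_deriv_Moebius_compose[OF holf]) (use f1 p z in auto)
  then have eq: "(1 - (cmod (f z))\<^sup>2) * (2 * sqrt b * cmod (deriv s z)) = (1 - b\<^sup>2) * cmod (deriv f z)"
    by (simp add: dg norm_mult sb)
  have fz: "0 < 1 - (cmod (f z))\<^sup>2" using f1[OF z] by (auto simp: abs_square_less_1)
  \<comment> \<open>Multiplying by \<open>1 - b\<close> turns \<open>1 + b\<close> into the kernel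
    \<open>1 - b\<^sup>2\<close> that links \<open>deriv f\<close> with \<open>deriv s\<close> in
    \<open>eq\<close>; the factor is cancelled at the end.\<close>
  have "(1 - b) * ((1 - (cmod z)\<^sup>2) * cmod (deriv f z) * (1 + b)) = (1 - (cmod z)\<^sup>2) * ((1 - b\<^sup>2) * cmod (deriv f z))"
    by (simp add: algebra_simps power2_eq_square)
  also have "\<dots> = ((1 - (cmod z)\<^sup>2) * cmod (deriv s z)) * (2 * sqrt b * (1 - (cmod (f z))\<^sup>2))"
    unfolding eq[symmetric] by (simp add: algebra_simps)
  also have "\<dots> \<le> (1 - b) * (2 * sqrt b * (1 - (cmod (f z))\<^sup>2))"
    by (rule mult_right_mono) (use SP bs fz b1 in auto)
  finally show ?thesis using b1 by simp
qed

lemma disc_kernel_zero_right: "disc_kernel p 0 = 1 - (cmod p)\<^sup>2"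
  by (simp add: disc_kernel_def)

text \<open>
  The error of the linearisation of \<open>exp (2 v)\<close> is of order \<open>(\<Sum> k\<^sup>2)\<^sup>2 \<le> (\<Sum> k) (\<Sum> k\<^sup>3)\<close>; the summand
  \<open>2 k\<^sup>3\<close> of the weight is there to absorb it.
\<close>

lemma exp_correction_inequality:
  fixes k :: "'a \<Rightarrow> real" and c :: real
  assumes k: "\<And>p. p \<in> P \<Longrightarrow> 0 \<le> k p \<and> k p \<le> 1 / 9" and S: "(\<Sum>p\<in>P. k p) \<le> M"
    and c: "0 \<le> c" "8 * c * M \<le> 1" "2 * c * (\<Sum>p\<in>P. (k p)\<^sup>2 + 2 * k p ^ 3) \<le> 1"
  shows "exp (2 * c * (\<Sum>p\<in>P. (k p)\<^sup>2 + 2 * k p ^ 3)) \<le>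
         1 + c * (\<Sum>p\<in>P. (k p)\<^sup>2 * (2 + 8 * k p - 18 * (k p)\<^sup>2))"
proof -
  define A where "A = (\<Sum>p\<in>P. (k p)\<^sup>2 + 2 * k p ^ 3)"
  define B where "B = (\<Sum>p\<in>P. k p ^ 3)"
  have B0: "0 \<le> B" unfolding B_def by (intro sum_nonneg) (use k in auto)
  have A0: "0 \<le> A" unfolding A_def by (intro sum_nonneg) (use k in auto)
  \<comment> \<open>Cauchy-Schwarz for the splitting
    \<open>k\<^sup>2 = k^(1/2) k^(3/2)\<close>.\<close>
  have "(\<Sum>p\<in>P. (k p)\<^sup>2)\<^sup>2 = (\<Sum>p\<in>P. sqrt (k p) * (k p * sqrt (k p)))\<^sup>2"
    using k by (intro arg_cong[where f = "\<lambda>x. x\<^sup>2"] sum.cong) (auto simp: power2_eq_square)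
  also have "\<dots> \<le> (\<Sum>p\<in>P. (sqrt (k p))\<^sup>2) * (\<Sum>p\<in>P. (k p * sqrt (k p))\<^sup>2)"
    by (rule Cauchy_Schwarz_ineq_sum)
  also have "\<dots> = (\<Sum>p\<in>P. k p) * B"
    unfolding B_def using k
    by (intro arg_cong2[where f = "(*)"] sum.cong) (auto simp: power_mult_distrib power2_eq_square power3_eq_cube)
  also have "\<dots> \<le> M * B" using S B0 by (rule mult_right_mono)
  finally have CS: "(\<Sum>p\<in>P. (k p)\<^sup>2)\<^sup>2 \<le> M * B" .
  have "(k p)\<^sup>2 + 2 * k p ^ 3 \<le> 2 * (k p)\<^sup>2" if "p \<in> P" for p
    using mult_left_mono[of "k p" "1/2" "2 * (k p)\<^sup>2"] k[OF that] by (simp add: power2_eq_square power3_eq_cube algebra_simps)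
  then have "A \<le> (\<Sum>p\<in>P. 2 * (k p)\<^sup>2)" unfolding A_def by (rule sum_mono)
  then have "A\<^sup>2 \<le> (2 * (\<Sum>p\<in>P. (k p)\<^sup>2))\<^sup>2"
    using A0 by (intro power_mono) (simp_all add: sum_distrib_left)
  also have "\<dots> \<le> 4 * (M * B)" using CS by (simp add: power_mult_distrib)
  finally have AB: "A\<^sup>2 \<le> 4 * M * B" by simp
  have low: "2 * A + 2 * B \<le> (\<Sum>p\<in>P. (k p)\<^sup>2 * (2 + 8 * k p - 18 * (k p)\<^sup>2))"
  proof -
    \<comment> \<open>The right side minus the left side is \<open>2 k^3 - 18 k^4\<close>; this is
      where the threshold \<open>1 / 9\<close> for the kernels comes from.\<close>
    have "2 * ((k p)\<^sup>2 + 2 * k p ^ 3) + 2 * k p ^ 3 \<le> (k p)\<^sup>2 * (2 + 8 * k p - 18 * (k p)\<^sup>2)" if "p \<in> P" for p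
      using mult_left_mono[of "k p" "1/9" "18 * k p ^ 3"] k[OF that]
      by (simp add: power2_eq_square power3_eq_cube algebra_simps)
    then have "(\<Sum>p\<in>P. 2 * ((k p)\<^sup>2 + 2 * k p ^ 3) + 2 * k p ^ 3) \<le> (\<Sum>p\<in>P. (k p)\<^sup>2 * (2 + 8 * k p - 18 * (k p)\<^sup>2))"
      by (rule sum_mono)
    also have "(\<Sum>p\<in>P. 2 * ((k p)\<^sup>2 + 2 * k p ^ 3) + 2 * k p ^ 3) = 2 * A + 2 * B"
      unfolding A_def B_def by (simp add: sum.distrib sum_distrib_left[symmetric])
    finally show ?thesis .
  qed
  have "exp (2 * c * A) \<le> 1 + 2 * c * A + (2 * c * A)\<^sup>2"
    using exp_bound[of "2 * c * A"] A0 c by (simp add: A_def)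
  also have "(2 * c * A)\<^sup>2 \<le> 2 * c * B"
  proof -
    have "(2 * c * A)\<^sup>2 = 4 * c\<^sup>2 * A\<^sup>2" by (simp add: power_mult_distrib)
    also have "\<dots> \<le> 4 * c\<^sup>2 * (4 * M * B)" using AB by (intro mult_left_mono) auto
    also have "\<dots> = (2 * c * B) * (8 * c * M)" by (simp add: power2_eq_square)
    also have "\<dots> \<le> (2 * c * B) * 1" using c B0 by (intro mult_left_mono) auto
    finally show ?thesis by simp
  qed
  also have "1 + 2 * c * A + 2 * c * B = 1 + c * (2 * A + 2 * B)" by (simp add: algebra_simps)
  also have "\<dots> \<le> 1 + c * (\<Sum>p\<in>P. (k p)\<^sup>2 * (2 + 8 * k p - 18 * (k p)\<^sup>2))"
    using low c by (intro add_left_mono mult_left_mono) auto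
  finally show ?thesis by (simp add: A_def)
qed

section \<open>The maximum principle for the weighted hyperbolic derivative\<close>

text \<open>\<open>F\<close> is the logarithm of the function \<open>E\<close> of the overview, and
  its Laplacian at a maximum is at most 0. As \<open>ln |f'|\<close> is harmonic and the other two
  logarithms give curvature terms, this compares \<open>|f'| / (1 - |f|\<^sup>2)\<close> with the
  hyperbolic density at \<open>z\<close>, as in Ahlfors' lemma, with the Laplacian of the weight as
  an extra term.\<close>

lemma has_laplacian_log_weighted_derivative:
  assumes holf: "f holomorphic_on ball 0 1" and f1: "\<And>z. cmod z < 1 \<Longrightarrow> cmod (f z) < 1" and z: "cmod z < 1"
    and P: "\<And>p. p \<in> P \<Longrightarrow> cmod p < 1" and d0: "deriv f z \<noteq> 0"
    and F: "\<And>w. F w = c * (\<Sum>p\<in>P. (disc_kernel p (f w))\<^sup>2 + 2 * disc_kernel p (f w) ^ 3)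
             + ln (1 - (cmod w)\<^sup>2) - ln (1 - (cmod (f w))\<^sup>2) + ln (cmod (deriv f w))"
    and mx: "\<forall>\<^sub>F w in nhds z. F w \<le> F z"
  shows "(cmod (deriv f z) / (1 - (cmod (f z))\<^sup>2))\<^sup>2 * 
          (1 + c * (\<Sum>p\<in>P. (disc_kernel p (f z))\<^sup>2 * (2 + 8 * disc_kernel p (f z) - 18 * (disc_kernel p (f z))\<^sup>2)))
         \<le> (1 / (1 - (cmod z)\<^sup>2))\<^sup>2"
proof -
  \<comment> \<open>The weight in terms of \<open>x = |B|\<^sup>2 = 1 - k\<close>, the form that the
    Laplacian formula requires; the factor \<open>2 + 8 k - 18 k\<^sup>2\<close> is the derivative
    of \<open>x \<psi>' x\<close>.\<close>
  define \<psi> :: "real \<Rightarrow> real" where "\<psi> = (\<lambda>x. (1 - x)\<^sup>2 + 2 * (1 - x) ^ 3)"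
  define g where "g = (\<lambda>p w. Moebius_function 0 p (f w))"
  \<comment> \<open>\<open>G\<close> equals \<open>F\<close> near \<open>z\<close> but is built only
    from functions of squared moduli of holomorphic functions; hence half the logarithm of
    \<open>|f'|\<^sup>2\<close>.\<close>
  define G where "G = (\<lambda>w. c * (\<Sum>p\<in>P. \<psi> ((cmod (g p w))\<^sup>2)) + ln (1 - (cmod w)\<^sup>2) 
       + (-1) * ln (1 - (cmod (f w))\<^sup>2) + ln ((cmod (deriv f w))\<^sup>2) / 2)"
  define k where "k = (\<lambda>p. disc_kernel p (f z))"
  define D where "D = cmod (deriv f z) / (1 - (cmod (f z))\<^sup>2)"
  have holg: "g p holomorphic_on ball 0 1" if "p \<in> P" for p
    unfolding g_def using P[OF that] f1
    by (intro holomorphic_on_compose_gen[OF holf Moebius_function_holomorphic, unfolded o_def]) auto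
  have gk: "(cmod (g p w))\<^sup>2 = 1 - disc_kernel p (f w)" if "p \<in> P" "cmod w < 1" for p w
    unfolding g_def by (rule norm_Moebius_power2) (use that P f1 in auto)
  have fz: "0 < 1 - (cmod (f z))\<^sup>2" "0 < 1 - (cmod z)\<^sup>2" using f1[OF z] z by (auto simp: abs_square_less_1)
  have L1: "has_laplacian (\<lambda>w. \<psi> ((cmod (g p w))\<^sup>2)) (4 * (D\<^sup>2 * (k p)\<^sup>2 * (2 + 8 * k p - 18 * (k p)\<^sup>2))) z" if p: "p \<in> P" for p
  proof -
    have "has_laplacian (\<lambda>w. \<psi> ((cmod (g p w))\<^sup>2))
           (4 * (cmod (deriv (g p) z))\<^sup>2 * ((\<lambda>x. - 2 * (1 - x) - 6 * (1 - x)\<^sup>2) ((cmod (g p z))\<^sup>2) 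
              + (cmod (g p z))\<^sup>2 * (2 + 12 * (1 - (cmod (g p z))\<^sup>2)))) z"
      by (rule has_laplacian_compose_norm_power2[OF holg[OF p]])
         (use z in \<open>auto simp: \<psi>_def intro!: derivative_eq_intros always_eventually\<close>)
    moreover have "(cmod (deriv (g p) z))\<^sup>2 = D\<^sup>2 * (k p)\<^sup>2"
    proof -
      have "(1 - (cmod (f z))\<^sup>2) * cmod (deriv (g p) z) = k p * cmod (deriv f z)"
        unfolding g_def k_def by (rule norm_deriv_Moebius_compose[OF holf]) (use z P p f1 in auto)
      then have "cmod (deriv (g p) z) = D * k p" using fz by (simp add: D_def field_simps)
      then show ?thesis by (simp add: power_mult_distrib)
    qed
    moreover have "(\<lambda>x. - 2 * (1 - x) - 6 * (1 - x)\<^sup>2) ((cmod (g p z))\<^sup>2) 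
              + (cmod (g p z))\<^sup>2 * (2 + 12 * (1 - (cmod (g p z))\<^sup>2)) = 2 + 8 * k p - 18 * (k p)\<^sup>2"
      unfolding gk[OF p z] k_def by (simp add: algebra_simps power2_eq_square)
    ultimately show ?thesis by (simp only: mult.assoc)
  qed
  have lnd: "\<forall>\<^sub>F x in nhds x0. ((\<lambda>x. ln (1 - x)) has_real_derivative - (1 / (1 - x))) (at x)" if "x0 < 1" for x0 :: real
  proof -
    have "\<forall>\<^sub>F x in nhds x0. x < 1" using that by (rule order_tendstoD[OF filterlim_ident])
    then show ?thesis by eventually_elim (auto intro!: derivative_eq_intros simp: field_simps)
  qed
  have lnd2: "((\<lambda>x. - (1 / (1 - x))) has_real_derivative - (1 / (1 - x)\<^sup>2)) (at x)" if "x < 1" for x :: real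
    using that by (auto intro!: derivative_eq_intros simp: field_simps power2_eq_square)
  have L2': "has_laplacian (\<lambda>w. ln (1 - (cmod (h w))\<^sup>2)) (- 4 * (cmod (deriv h z) / (1 - (cmod (h z))\<^sup>2))\<^sup>2) z" 
    if h: "h holomorphic_on ball 0 1" "cmod (h z) < 1" for h
  proof -
    have h1: "(cmod (h z))\<^sup>2 < 1" using h by (auto simp: abs_square_less_1)
    have "has_laplacian (\<lambda>w. ln (1 - (cmod (h w))\<^sup>2)) 
        (4 * (cmod (deriv h z))\<^sup>2 * (- (1 / (1 - (cmod (h z))\<^sup>2)) + (cmod (h z))\<^sup>2 * (- (1 / (1 - (cmod (h z))\<^sup>2)\<^sup>2)))) z"
      by (rule has_laplacian_compose_norm_power2[OF h(1) _ _ lnd lnd2]) (use z h1 in auto)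
    moreover have "- (1 / (1 - x)) + x * (- (1 / (1 - x)\<^sup>2)) = - (1 / (1 - x)\<^sup>2)" if "x < 1" for x :: real
      using that by (simp add: divide_simps) (simp add: algebra_simps power2_eq_square)
    ultimately show ?thesis using h1 by (simp add: power_divide)
  qed
  have L2: "has_laplacian (\<lambda>w. ln (1 - (cmod w)\<^sup>2)) (- 4 * (1 / (1 - (cmod z)\<^sup>2))\<^sup>2) z"
    using L2'[of "\<lambda>w. w"] z by (simp add: holomorphic_intros)
  have L3: "has_laplacian (\<lambda>w. ln (1 - (cmod (f w))\<^sup>2)) (- 4 * D\<^sup>2) z"
    using L2'[OF holf] f1 z by (simp add: D_def)
  have L4: "has_laplacian (\<lambda>w. ln ((cmod (deriv f w))\<^sup>2) / 2) 0 z"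
  proof -
    define y where "y = (cmod (deriv f z))\<^sup>2"
    have y: "y > 0" using d0 by (simp add: y_def)
    have "has_laplacian (\<lambda>w. (\<lambda>x. ln x / 2) ((cmod (deriv f w))\<^sup>2)) 
        (4 * (cmod (deriv (deriv f) z))\<^sup>2 * ((\<lambda>x. 1 / (2 * x)) ((cmod (deriv f z))\<^sup>2) + (cmod (deriv f z))\<^sup>2 * (- (1 / (2 * y\<^sup>2))))) z"
    proof (rule has_laplacian_compose_norm_power2[OF holomorphic_deriv[OF holf]])
      have "\<forall>\<^sub>F x in nhds y. 0 < x" using y by (rule order_tendstoD[OF filterlim_ident])
      then show "\<forall>\<^sub>F x in nhds ((cmod (deriv f z))\<^sup>2). ((\<lambda>x. ln x / 2) has_real_derivative 1 / (2 * x)) (at x)"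
        unfolding y_def by eventually_elim (auto intro!: derivative_eq_intros simp: field_simps)
      show "((\<lambda>x. 1 / (2 * x)) has_real_derivative - (1 / (2 * y\<^sup>2))) (at ((cmod (deriv f z))\<^sup>2))"
        using y unfolding y_def[symmetric] by (auto intro!: derivative_eq_intros simp: field_simps power2_eq_square)
    qed (use z in auto)
    moreover have "1 / (2 * y) + y * (- (1 / (2 * y\<^sup>2))) = 0" using y by (simp add: power2_eq_square)
    ultimately show ?thesis by (simp add: y_def)
  qed
  have "has_laplacian G (c * (\<Sum>p\<in>P. 4 * (D\<^sup>2 * (k p)\<^sup>2 * (2 + 8 * k p - 18 * (k p)\<^sup>2))) + - 4 * (1 / (1 - (cmod z)\<^sup>2))\<^sup>2 
       + (-1) * (- 4 * D\<^sup>2) + 0) z"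
    unfolding G_def
    by (intro has_laplacian_add has_laplacian_cmult has_laplacian_sum L1 L2 L3 L4)
  moreover have "\<forall>\<^sub>F w in nhds z. G w \<le> G z"
  proof -
    have eq: "G w = F w" if "w \<in> ball 0 1" "deriv f w \<noteq> 0" for w
    proof -
      have "(\<Sum>p\<in>P. \<psi> ((cmod (g p w))\<^sup>2)) = (\<Sum>p\<in>P. (disc_kernel p (f w))\<^sup>2 + 2 * disc_kernel p (f w) ^ 3)"
        by (intro sum.cong refl) (use that in \<open>simp add: gk \<psi>_def\<close>)
      then show ?thesis using that by (simp add: G_def F ln_realpow)
    qed
    have "\<forall>\<^sub>F w in nhds z. w \<in> ball 0 1" 
      using z by (intro eventually_nhds_in_open) auto
    moreover have "\<forall>\<^sub>F w in nhds z. deriv f w \<noteq> 0"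
    proof -
      have "continuous_on (ball 0 1) (deriv f)"
        by (intro holomorphic_on_imp_continuous_on holomorphic_deriv holf) auto
      then have "isCont (deriv f) z" using z by (simp add: continuous_on_eq_continuous_at)
      then have "(deriv f \<longlongrightarrow> deriv f z) (nhds z)" by (simp add: isCont_def tendsto_at_iff_tendsto_nhds)
      then show ?thesis using d0 by (rule tendsto_imp_eventually_ne)
    qed
    ultimately show ?thesis using mx
      by eventually_elim (use eq d0 z in auto)
  qed
  ultimately have "c * (\<Sum>p\<in>P. 4 * (D\<^sup>2 * (k p)\<^sup>2 * (2 + 8 * k p - 18 * (k p)\<^sup>2))) + - 4 * (1 / (1 - (cmod z)\<^sup>2))\<^sup>2 
       + (-1) * (- 4 * D\<^sup>2) + 0 \<le> 0"
    by (rule has_laplacian_local_max)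
  moreover have "(\<Sum>p\<in>P. 4 * (D\<^sup>2 * (k p)\<^sup>2 * (2 + 8 * k p - 18 * (k p)\<^sup>2))) 
     = 4 * D\<^sup>2 * (\<Sum>p\<in>P. (k p)\<^sup>2 * (2 + 8 * k p - 18 * (k p)\<^sup>2))"
    by (simp add: sum_distrib_left mult.assoc)
  ultimately show ?thesis by (simp add: k_def D_def algebra_simps)
qed

text \<open>Holomorphy on a disc of radius \<open>R > 1\<close> makes \<open>E\<close> continuous on
  the closed unit disc, so it attains a maximum. It vanishes on the unit circle, so a maximum above
  1 is interior, where it contradicts either the gain from the square root or the Laplacian
  inequality.\<close>

lemma deriv_bound_omitted_values_aux:
  assumes holf: "f holomorphic_on ball 0 R" and R: "1 < R" 
    and f1: "\<And>z. cmod z < R \<Longrightarrow> cmod (f z) < 1" and f0: "f 0 = 0"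
    and P: "\<And>p. p \<in> P \<Longrightarrow> cmod p < 1" "\<And>p z. p \<in> P \<Longrightarrow> cmod z < R \<Longrightarrow> f z \<noteq> p"
    and S: "\<And>w. cmod w < 1 \<Longrightarrow> (\<Sum>p\<in>P. disc_kernel p w) \<le> 600"
  shows "cmod (deriv f 0) \<le> exp (- (1 / 10^7) * (\<Sum>p\<in>P. (1 - (cmod p)\<^sup>2)\<^sup>2))"
proof -
  \<comment> \<open>The size of \<open>c\<close> is dictated by the case near an omitted point:
    \<open>2 v \<le> 3600 c\<close> must stay below the gain \<open>1 / 1600\<close> found
    there.\<close>
  define c :: real where "c = 1 / 10^7"
  define v where "v = (\<lambda>w. c * (\<Sum>p\<in>P. (disc_kernel p w)\<^sup>2 + 2 * disc_kernel p w ^ 3))"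
  define E where "E = (\<lambda>z. exp (v (f z)) * ((1 - (cmod z)\<^sup>2) * cmod (deriv f z) / (1 - (cmod (f z))\<^sup>2)))"
  have sub: "cball 0 1 \<subseteq> ball (0::complex) R" using R by auto
  have f1': "cmod (f z) < 1" if "z \<in> cball 0 1" for z using f1 sub that by fastforce
  have f1'': "cmod (f z) < 1" if "cmod z < 1" for z using f1' that by auto
  have hol1: "f holomorphic_on ball 0 1" using holf R by (rule_tac holomorphic_on_subset) auto
  have contf: "continuous_on (cball 0 1) f"
    using holomorphic_on_imp_continuous_on[OF holf] sub by (rule continuous_on_subset)
  have contd: "continuous_on (cball 0 1) (deriv f)"
    using holomorphic_on_imp_continuous_on[OF holomorphic_deriv[OF holf]] sub by (auto intro: continuous_on_subset)
  have fpos: "0 < 1 - (cmod (f z))\<^sup>2" if "z \<in> cball 0 1" for z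
    using f1'[OF that] by (auto simp: abs_square_less_1)
  have contk: "continuous_on (cball 0 1) (\<lambda>z. disc_kernel p (f z))" if "p \<in> P" for p
    unfolding disc_kernel_def using one_minus_cnj_mult_neq_0[OF P(1)[OF that]] f1'
    by (intro continuous_intros contf) auto
  have contE: "continuous_on (cball 0 1) E"
    unfolding E_def v_def using fpos
    by (intro continuous_intros contf contd contk) (auto simp: less_le)
  obtain z where z: "z \<in> cball 0 1" "\<And>w. w \<in> cball 0 1 \<Longrightarrow> E w \<le> E z"
    using continuous_attains_sup[OF compact_cball _ contE] by auto
  define k where "k = (\<lambda>p. disc_kernel p (f z))"
  have kb: "0 < k p" "k p \<le> 1" if "p \<in> P" for p
    using disc_kernel_bounds[OF P(1)[OF that] f1'[OF z(1)]] by (auto simp: k_def)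
  have vk: "v (f z) = c * (\<Sum>p\<in>P. (k p)\<^sup>2 + 2 * k p ^ 3)" by (simp add: v_def k_def)
  have v1: "v (f z) \<le> 1800 * c"
  proof -
    have "(k p)\<^sup>2 + 2 * k p ^ 3 \<le> 3 * k p" if "p \<in> P" for p
      using kb[OF that] power_decreasing[of 1 2 "k p"] power_decreasing[of 1 3 "k p"] by simp
    then have "(\<Sum>p\<in>P. (k p)\<^sup>2 + 2 * k p ^ 3) \<le> (\<Sum>p\<in>P. 3 * k p)" by (rule sum_mono)
    also have "\<dots> \<le> 3 * 600" using S[OF f1'[OF z(1)]] by (simp add: k_def sum_distrib_left[symmetric])
    finally show ?thesis unfolding vk by (simp add: c_def)
  qed
  have v0: "0 \<le> v (f z)" unfolding vk using kb by (intro mult_nonneg_nonneg sum_nonneg) (auto simp: c_def less_imp_le)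
  have Ez: "E z \<le> 1"
  proof (rule ccontr)
    assume "\<not> E z \<le> 1"
    then have E1: "1 < E z" by simp
    have z1: "cmod z < 1"
    proof (rule ccontr)
      assume "\<not> cmod z < 1"
      then have "cmod z = 1" using z(1) by simp
      then have "E z = 0" by (simp add: E_def)
      with E1 show False by simp
    qed
    have d0: "deriv f z \<noteq> 0" using E1 by (auto simp: E_def)
    have zpos: "0 < 1 - (cmod z)\<^sup>2" using z1 by (auto simp: abs_square_less_1)
    note fz = fpos[OF z(1)]
    show False
    \<comment> \<open>If some kernel exceeds \<open>1 / 9\<close>, then \<open>f z\<close> is
      hyperbolically close to an omitted point and the omission itself gives a definite gain.
      Otherwise all kernels are in the range of \<open>exp_correction_inequality\<close>.\<close>
    proof (cases "\<exists>p\<in>P. 1 / 9 < k p")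
      case True
      then obtain p where p: "p \<in> P" "1 / 9 < k p" by blast
      define b where "b = cmod (Moebius_function 0 p (f z))"
      have b2: "b\<^sup>2 = 1 - k p"
        unfolding b_def k_def by (rule norm_Moebius_power2) (use P p f1' z in auto)
      have b: "0 \<le> b" "b \<le> 19 / 20"
      proof -
        show "0 \<le> b" by (simp add: b_def)
        have "b\<^sup>2 \<le> (19 / 20)\<^sup>2" using b2 p by (simp add: power2_eq_square)
        then show "b \<le> 19 / 20" by (rule power2_le_imp_le) auto
      qed
      define q where "q = (1 - (cmod z)\<^sup>2) * cmod (deriv f z) / (1 - (cmod (f z))\<^sup>2)"
      have "(1 - (cmod z)\<^sup>2) * cmod (deriv f z) * (1 + b) \<le> 2 * sqrt b * (1 - (cmod (f z))\<^sup>2)"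
        by (rule Schwarz_Pick_omitted_value[OF hol1 f1'' z1 P(1)[OF p(1)] _ b_def]) (use P(2) p R in auto)
      then have "q * (1 + b) \<le> 2 * sqrt b" using fz by (simp add: q_def field_simps)
      moreover have q0: "0 \<le> q" using fz zpos by (simp add: q_def)
      ultimately have "(q * (1 + b))\<^sup>2 \<le> (2 * sqrt b)\<^sup>2" using b by (intro power_mono) auto
      then have "q\<^sup>2 * (1 + b)\<^sup>2 \<le> 4 * b" using b by (simp add: power_mult_distrib)
      \<comment> \<open>\<open>4 b = (1 + b)\<^sup>2 - (1 - b)\<^sup>2\<close>, and
        \<open>b \<le> 19 / 20\<close> makes \<open>1 - b\<close> at least one fortieth of
        \<open>1 + b\<close>.\<close>
      moreover have "4 * b \<le> (1 - 1 / 1600) * (1 + b)\<^sup>2"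
      proof -
        have "(1 + b) / 40 \<le> 1 - b" using b by simp
        then have "((1 + b) / 40)\<^sup>2 \<le> (1 - b)\<^sup>2" using b by (intro power_mono) auto
        then show ?thesis by (simp add: power2_eq_square field_simps)
      qed
      ultimately have "q\<^sup>2 * (1 + b)\<^sup>2 \<le> (1 - 1 / 1600) * (1 + b)\<^sup>2" by linarith
      then have "q\<^sup>2 \<le> 1 - 1 / 1600" using b by (auto simp: mult_le_cancel_right)
      also have "\<dots> \<le> exp (- (1 / 1600))" using exp_ge_add_one_self[of "- (1/1600)"] by simp
      finally have "(exp (v (f z)))\<^sup>2 * q\<^sup>2 \<le> (exp (v (f z)))\<^sup>2 * exp (- (1 / 1600))"
        by (intro mult_left_mono) auto
      also have "\<dots> = exp (2 * v (f z) - 1 / 1600)" by (simp add: exp_double[symmetric] exp_add[symmetric])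
      also have "\<dots> \<le> 1" using v1 by (simp add: c_def)
      finally have "(exp (v (f z)) * q)\<^sup>2 \<le> 1" by (simp only: power_mult_distrib)
      moreover have "E z = exp (v (f z)) * q" by (simp add: E_def q_def)
      ultimately have "(E z)\<^sup>2 \<le> 1" by simp
      with E1 show False by (simp add: abs_square_le_1)
    next
      case False
      define F where "F = (\<lambda>w. c * (\<Sum>p\<in>P. (disc_kernel p (f w))\<^sup>2 + 2 * disc_kernel p (f w) ^ 3)
             + ln (1 - (cmod w)\<^sup>2) - ln (1 - (cmod (f w))\<^sup>2) + ln (cmod (deriv f w)))"
      have FE: "F w = ln (E w)" if "cmod w < 1" "deriv f w \<noteq> 0" for w
      proof -
        have "0 < 1 - (cmod w)\<^sup>2" "0 < 1 - (cmod (f w))\<^sup>2" using that fpos[of w] by (auto simp: abs_square_less_1)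
        then show ?thesis using that by (simp add: F_def E_def v_def ln_mult ln_div)
      qed
      have mx: "\<forall>\<^sub>F w in nhds z. F w \<le> F z"
      proof -
        have "\<forall>\<^sub>F w in nhds z. w \<in> ball 0 1" 
          using z1 by (intro eventually_nhds_in_open) auto
        moreover have "\<forall>\<^sub>F w in nhds z. deriv f w \<noteq> 0"
        proof -
          have "continuous_on (ball 0 1) (deriv f)"
            by (intro holomorphic_on_imp_continuous_on holomorphic_deriv hol1) auto
          then have "isCont (deriv f) z" using z1 by (simp add: continuous_on_eq_continuous_at)
          then have "(deriv f \<longlongrightarrow> deriv f z) (nhds z)" by (simp add: isCont_def tendsto_at_iff_tendsto_nhds)
          then show ?thesis using d0 by (rule tendsto_imp_eventually_ne)
        qed
        ultimately show ?thesis
        proof eventually_elim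
          case (elim w)
          have "0 < 1 - (cmod w)\<^sup>2" "0 < 1 - (cmod (f w))\<^sup>2" using elim fpos[of w] by (auto simp: abs_square_less_1)
          then have "0 < E w" using elim by (simp add: E_def)
          moreover have "E w \<le> E z" using z(2)[of w] elim by simp
          ultimately show ?case using FE[of w] FE[of z] elim z1 d0 by simp
        qed
      qed
      have lap: "(cmod (deriv f z) / (1 - (cmod (f z))\<^sup>2))\<^sup>2 * 
          (1 + c * (\<Sum>p\<in>P. (k p)\<^sup>2 * (2 + 8 * k p - 18 * (k p)\<^sup>2))) \<le> (1 / (1 - (cmod z)\<^sup>2))\<^sup>2"
        unfolding k_def
        by (rule has_laplacian_log_weighted_derivative[OF hol1 f1'' z1 P(1) d0 _ mx]) (auto simp: F_def)
      have "exp (2 * c * (\<Sum>p\<in>P. (k p)\<^sup>2 + 2 * k p ^ 3)) \<le>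
         1 + c * (\<Sum>p\<in>P. (k p)\<^sup>2 * (2 + 8 * k p - 18 * (k p)\<^sup>2))"
      proof (rule exp_correction_inequality)
        show "0 \<le> k p \<and> k p \<le> 1 / 9" if "p \<in> P" for p
          using False kb that by (auto simp: not_less less_imp_le)
        show "(\<Sum>p\<in>P. k p) \<le> 600" using S[OF f1'[OF z(1)]] by (simp add: k_def)
        show "2 * c * (\<Sum>p\<in>P. (k p)\<^sup>2 + 2 * k p ^ 3) \<le> 1" using v1 unfolding vk by (simp add: c_def)
      qed (auto simp: c_def)
      then have "(cmod (deriv f z) / (1 - (cmod (f z))\<^sup>2))\<^sup>2 * exp (2 * v (f z)) \<le> (1 / (1 - (cmod z)\<^sup>2))\<^sup>2"
        using lap by (elim order_trans[rotated]) (auto simp: vk mult.assoc intro!: mult_left_mono)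
      then have "(1 - (cmod z)\<^sup>2)\<^sup>2 * ((cmod (deriv f z) / (1 - (cmod (f z))\<^sup>2))\<^sup>2 * exp (2 * v (f z))) 
          \<le> (1 - (cmod z)\<^sup>2)\<^sup>2 * (1 / (1 - (cmod z)\<^sup>2))\<^sup>2"
        by (rule mult_left_mono) auto
      also have "\<dots> = 1" using zpos by (simp add: power_divide)
      also have "(1 - (cmod z)\<^sup>2)\<^sup>2 * ((cmod (deriv f z) / (1 - (cmod (f z))\<^sup>2))\<^sup>2 * exp (2 * v (f z))) = (E z)\<^sup>2"
        by (simp add: E_def exp_double power_mult_distrib power_divide)
      finally show False using E1 by (simp add: abs_square_le_1)
    qed
  qed
  have "exp (v 0) * cmod (deriv f 0) \<le> 1"
    using z(2)[of 0] Ez by (simp add: E_def f0)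
  moreover have "(1 / 10^7) * (\<Sum>p\<in>P. (1 - (cmod p)\<^sup>2)\<^sup>2) \<le> v 0"
  proof -
    have "(\<Sum>p\<in>P. (1 - (cmod p)\<^sup>2)\<^sup>2) \<le> (\<Sum>p\<in>P. (disc_kernel p 0)\<^sup>2 + 2 * disc_kernel p 0 ^ 3)"
      using disc_kernel_bounds(1)[OF P(1), of _ 0] 
      by (intro sum_mono) (auto simp: disc_kernel_zero_right less_imp_le)
    then show ?thesis by (simp add: v_def c_def)
  qed
  ultimately have "cmod (deriv f 0) \<le> exp (- v 0)"
    by (simp add: exp_minus field_simps)
  also have "\<dots> \<le> exp (- (1 / 10^7) * (\<Sum>p\<in>P. (1 - (cmod p)\<^sup>2)\<^sup>2))"
    using \<open>_ \<le> v 0\<close> by simp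
  finally show ?thesis .
qed

text \<open>The dilations \<open>f (s z)\<close> with \<open>s < 1\<close> are holomorphic on a disc
  of radius \<open>1 / s > 1\<close>, omit the same points and have derivative
  \<open>s f'(0)\<close> at 0; then \<open>s\<close> tends to 1.\<close>

lemma deriv_bound_omitted_values:
  assumes holf: "f holomorphic_on ball 0 1"
    and f1: "\<And>z. cmod z < 1 \<Longrightarrow> cmod (f z) < 1" and f0: "f 0 = 0"
    and P: "\<And>p. p \<in> P \<Longrightarrow> cmod p < 1" "\<And>p z. p \<in> P \<Longrightarrow> cmod z < 1 \<Longrightarrow> f z \<noteq> p"
    and S: "\<And>w. cmod w < 1 \<Longrightarrow> (\<Sum>p\<in>P. disc_kernel p w) \<le> 600"
  shows "cmod (deriv f 0) \<le> exp (- (1 / 10^7) * (\<Sum>p\<in>P. (1 - (cmod p)\<^sup>2)\<^sup>2))" (is "_ \<le> ?B")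
proof -
  have "s * cmod (deriv f 0) \<le> ?B" if s: "0 < s" "s < 1" for s
  proof -
    define h where "h = (\<lambda>z. f (of_real s * z))"
    have dom: "cmod (of_real s * z) < 1" if "cmod z < 1 / s" for z
      using that s by (simp add: norm_mult field_simps)
    have "cmod (deriv h 0) \<le> ?B"
    proof (rule deriv_bound_omitted_values_aux)
      show "h holomorphic_on ball 0 (1 / s)"
        unfolding h_def
        by (rule holomorphic_on_compose_gen[of "\<lambda>z. of_real s * z" _ f "ball 0 1", unfolded o_def])
           (use dom holf in \<open>auto intro!: holomorphic_intros\<close>)
    qed (use s dom f1 P S f0 in \<open>auto simp: h_def\<close>)
    moreover have "(h has_field_derivative deriv f 0 * of_real s) (at 0)"
      unfolding h_def
      by (rule DERIV_chain2) (auto intro!: derivative_eq_intros holomorphic_derivI[OF holf])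
    then have "deriv h 0 = deriv f 0 * of_real s" by (rule DERIV_imp_deriv)
    ultimately show ?thesis using s by (simp add: norm_mult mult.commute)
  qed
  moreover have "((\<lambda>s. s * cmod (deriv f 0)) \<longlongrightarrow> 1 * cmod (deriv f 0)) (at_left 1)"
    by (intro tendsto_intros)
  moreover have "\<forall>\<^sub>F s in at_left (1::real). 0 < s \<and> s < 1"
    by (auto simp: eventually_at_left_field intro!: exI[of _ 0])
  ultimately have "1 * cmod (deriv f 0) \<le> ?B"
    by (intro tendsto_upperbound[of "\<lambda>s. s * cmod (deriv f 0)" _ "at_left 1"]) (auto elim: eventually_mono)
  then show ?thesis by simp
qed

subsection \<open>Bounding the sum of the kernels by a Poisson integral\<close>

lemma norm_exp_diff_le:
  assumes "Re a \<le> 0" "Re b \<le> 0"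
  shows "cmod (exp a - exp b) \<le> cmod (a - b)"
proof -
  have "convex {w. Re w \<le> 0}" by (rule convex_halfspace_Re_le)
  then have "cmod (exp a - exp b) \<le> 1 * cmod (a - b)"
    by (rule field_differentiable_bound[where f' = exp])
       (use assms in \<open>auto intro!: has_field_derivative_at_within[OF DERIV_exp]\<close>)
  then show ?thesis by simp
qed

lemma norm_diff_le_norm_one_minus_cnj_mult:
  assumes "cmod p < 1" "cmod w < 1"
  shows "cmod (p - w) \<le> cmod (1 - cnj p * w)"
proof (rule power2_le_imp_le)
  have "(cmod p)\<^sup>2 < 1" "(cmod w)\<^sup>2 < 1" using assms by (auto simp: abs_square_less_1)
  then show "(cmod (p - w))\<^sup>2 \<le> (cmod (1 - cnj p * w))\<^sup>2"
    by (simp add: norm_power2_one_minus_cnj_mult norm_minus_commute)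
qed simp

text \<open>Cauchy's formula on the unit circle for \<open>h\<close>, which has the value 1 at 0 and
  whose real part on the circle is the Poisson kernel.\<close>

lemma Poisson_kernel_has_integral:
  assumes z: "cmod z < 1"
  shows "((\<lambda>t. (1 - (cmod z)\<^sup>2) / (cmod (exp (2 * of_real pi * \<i> * of_real t) - z))\<^sup>2) has_integral 1) {0..1}"
proof -
  define h where "h = (\<lambda>u. (1 + cnj z * u) / (1 - cnj z * u))"
  have nz: "1 - cnj z * u \<noteq> 0" if "cmod u \<le> 1" for u
  proof
    assume "1 - cnj z * u = 0"
    then have "cmod (cnj z * u) = 1" by (metis eq_iff_diff_eq_0 norm_one)
    then have "cmod z * cmod u = 1" by (simp add: norm_mult)
    moreover have "cmod z * cmod u \<le> cmod z * 1"
      by (rule mult_left_mono) (use that in auto)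
    ultimately show False using z by simp
  qed
  have "h holomorphic_on cball 0 1"
    unfolding h_def using nz by (auto intro!: holomorphic_intros)
  then have "((\<lambda>u. h u / (u - 0)) has_contour_integral (2 * of_real pi * \<i> * h 0)) (circlepath 0 1)"
    by (rule Cauchy_integral_circlepath_simple) auto
  then have "((\<lambda>t. h (circlepath 0 1 t) / circlepath 0 1 t * vector_derivative (circlepath 0 1) (at t within {0..1}))
      has_integral (2 * of_real pi * \<i>)) {0..1}"
    by (simp add: has_contour_integral_def h_def)
  then have "((\<lambda>t. 2 * of_real pi * \<i> * h (exp (2 * of_real pi * \<i> * of_real t))) has_integral (2 * of_real pi * \<i>)) {0..1}"
    by (rule has_integral_eq[rotated])
       (simp add: vector_derivative_circlepath01, simp add: circlepath)
  from has_integral_mult_right[OF this, of "1 / (2 * of_real pi * \<i>)"]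
  have "((\<lambda>t. h (exp (2 * of_real pi * \<i> * of_real t))) has_integral 1) {0..1}"
    by simp
  from has_integral_Re[OF this] have "((\<lambda>t. Re (h (exp (2 * of_real pi * \<i> * of_real t)))) has_integral 1) {0..1}"
    by simp
  then show ?thesis
  proof (rule has_integral_eq[rotated])
    fix t :: real
    define u where "u = exp (2 * of_real pi * \<i> * of_real t)"
    have u: "cmod u = 1" by (simp add: u_def)
    have "h u = (1 + cnj z * u) * cnj (1 - cnj z * u) / of_real ((cmod (1 - cnj z * u))\<^sup>2)"
      unfolding h_def by (subst complex_div_cnj) simp
    then have "Re (h u) = Re ((1 + cnj z * u) * cnj (1 - cnj z * u)) / (cmod (1 - cnj z * u))\<^sup>2"
      by (metis Re_divide_of_real)
    also have "Re ((1 + cnj z * u) * cnj (1 - cnj z * u)) = 1 - (cmod (cnj z * u))\<^sup>2"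
      unfolding cmod_power2 by (simp add: algebra_simps power2_eq_square)
    also have "\<dots> = 1 - (cmod z)\<^sup>2" by (simp add: norm_mult u)
    also have "(cmod (1 - cnj z * u))\<^sup>2 = (cmod (u - z))\<^sup>2"
      by (simp add: norm_power2_one_minus_cnj_mult u)
    finally show "Re (h (exp (2 * of_real pi * \<i> * of_real t))) = 
       (1 - (cmod z)\<^sup>2) / (cmod (exp (2 * of_real pi * \<i> * of_real t) - z))\<^sup>2"
      by (simp add: u_def)
  qed
qed

text \<open>Arcs about points of one period may stick out at either end; three periods contain them
  without wrapping around.\<close>

lemma Poisson_kernel_has_integral_three:
  assumes z: "cmod z < 1"
  shows "((\<lambda>t. (1 - (cmod z)\<^sup>2) / (cmod (exp (2 * of_real pi * \<i> * of_real t) - z))\<^sup>2) has_integral 3) {-1..2}"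
proof -
  define P where "P = (\<lambda>t::real. (1 - (cmod z)\<^sup>2) / (cmod (exp (2 * of_real pi * \<i> * of_real t) - z))\<^sup>2)"
  have P01: "(P has_integral 1) {0..1}"
    unfolding P_def using z by (rule Poisson_kernel_has_integral)
  have per1: "P (t + 1) = P t" for t
    by (simp add: P_def algebra_simps exp_add)
  have per2: "P (t - 1) = P t" for t
    using per1[of "t - 1"] by simp
  have "((\<lambda>t. P (t + 1)) has_integral 1) {-1..0}"
    using has_integral_affinity[of P 1 0 1 1 1] P01 by (simp add: image_affinity_atLeastAtMost)
  then have A: "(P has_integral 1) {-1..0}" by (simp add: per1)
  have "((\<lambda>t. P (t - 1)) has_integral 1) {1..2}"
    using has_integral_affinity[of P 1 0 1 1 "-1"] P01 by (simp add: image_affinity_atLeastAtMost)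
  then have B: "(P has_integral 1) {1..2}" by (simp add: per2)
  have "(P has_integral 1 + 1) {-1..1}"
    by (rule has_integral_combine[OF _ _ A P01]) auto
  then have "(P has_integral (1 + 1) + 1) {-1..2}"
    by (rule has_integral_combine[OF _ _ _ B, rotated 2]) auto
  then show ?thesis by (simp add: P_def)
qed

lemma one_minus_exp_minus_bounds:
  fixes d :: real
  assumes "0 \<le> d" "d \<le> 1"
  shows "d / 2 \<le> 1 - exp (- d)" "1 - exp (- d) \<le> d"
proof -
  have "(1 - d / 2) * (1 + d) \<ge> 1" using assms mult_left_mono[of d 1 d] by (simp add: algebra_simps)
  also have "1 + d \<le> exp d" by (rule exp_ge_add_one_self)
  then have "(1 - d / 2) * (1 + d) \<le> (1 - d / 2) * exp d" using assms by (intro mult_left_mono) auto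
  finally show "d / 2 \<le> 1 - exp (- d)" by (simp add: exp_minus field_simps)
  show "1 - exp (- d) \<le> d" using exp_ge_add_one_self[of "- d"] by simp
qed

text \<open>Let \<open>d = - Re w\<close> and \<open>m = |1 - cnj (exp w) z|\<close>. The boundary
  point is within \<open>2 d\<close> of \<open>exp w\<close>, while \<open>d / 2\<close> and
  \<open>|exp w - z|\<close> are at most \<open>m\<close>; hence its distance from \<open>z\<close>
  is at most \<open>5 m\<close>. With \<open>1 - |exp w|\<^sup>2 \<le> 2 d\<close> this gives the
  constant \<open>50\<close>, twice the square of 5.\<close>

lemma disc_kernel_le_Poisson_kernel:
  assumes w: "-1 \<le> Re w" "Re w < 0" and z: "cmod z < 1" and \<theta>: "\<bar>\<theta> - Im w\<bar> \<le> - Re w"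
  shows "disc_kernel (exp w) z / (50 * (- Re w)) \<le> (1 - (cmod z)\<^sup>2) / (cmod (exp (\<i> * of_real \<theta>) - z))\<^sup>2"
proof -
  define d where "d = - Re w"
  define m where "m = cmod (1 - cnj (exp w) * z)"
  define \<zeta> where "\<zeta> = exp (\<i> * of_real \<theta>)"
  have d: "0 < d" "d \<le> 1" using w by (auto simp: d_def)
  have np: "cmod (exp w) = exp (- d)" by (simp add: d_def)
  have p1: "cmod (exp w) < 1" using w by simp
  have \<zeta>1: "cmod \<zeta> = 1" by (simp add: \<zeta>_def)
  have m0: "0 < m" using one_minus_cnj_mult_neq_0[OF p1 z] by (simp add: m_def)
  have z2: "0 < 1 - (cmod z)\<^sup>2" using z by (auto simp: abs_square_less_1)
  have "cmod (\<zeta> - exp w) \<le> cmod (\<i> * of_real \<theta> - w)"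
    unfolding \<zeta>_def by (rule norm_exp_diff_le) (use w in auto)
  also have "\<dots> \<le> \<bar>Re (\<i> * of_real \<theta> - w)\<bar> + \<bar>Im (\<i> * of_real \<theta> - w)\<bar>" by (rule cmod_le)
  also have "\<dots> \<le> 2 * d" using w \<theta> by (simp add: d_def)
  finally have a: "cmod (\<zeta> - exp w) \<le> 2 * d" .
  have b: "cmod (exp w - z) \<le> m"
    unfolding m_def by (rule norm_diff_le_norm_one_minus_cnj_mult[OF p1 z])
  have "1 - cmod (exp w) \<le> m"
  proof -
    have "cmod (cnj (exp w) * z) \<le> cmod (exp w) * 1"
      unfolding norm_mult complex_mod_cnj by (rule mult_left_mono) (use z in auto)
    moreover have "1 - cmod (cnj (exp w) * z) \<le> m"
      unfolding m_def using norm_triangle_ineq2[of 1 "cnj (exp w) * z"] by simp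
    ultimately show ?thesis by simp
  qed
  then have c: "d \<le> 2 * m" using one_minus_exp_minus_bounds(1)[of d] d np by simp
  have "cmod (\<zeta> - z) \<le> 5 * m"
    using norm_triangle_ineq[of "\<zeta> - exp w" "exp w - z"] a b c by simp
  then have "(cmod (\<zeta> - z))\<^sup>2 \<le> (5 * m)\<^sup>2" by (intro power_mono) auto
  moreover have "0 < (cmod (\<zeta> - z))\<^sup>2" using \<zeta>1 z by auto
  ultimately have "(1 - (cmod z)\<^sup>2) / (5 * m)\<^sup>2 \<le> (1 - (cmod z)\<^sup>2) / (cmod (\<zeta> - z))\<^sup>2"
    using z2 m0 by (intro divide_left_mono) auto
  moreover have "disc_kernel (exp w) z / (50 * d) \<le> (1 - (cmod z)\<^sup>2) / (5 * m)\<^sup>2"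
  proof -
    have "1 - (cmod (exp w))\<^sup>2 = (1 - exp (- d)) * (1 + exp (- d))"
      unfolding np by (simp add: algebra_simps power2_eq_square)
    also have "\<dots> \<le> d * 2"
      by (rule mult_mono) (use d one_minus_exp_minus_bounds(2)[of d] in auto)
    finally have "(1 - (cmod (exp w))\<^sup>2) / (50 * d) \<le> 1 / 25" using d by (simp add: field_simps)
    then have "(1 - (cmod (exp w))\<^sup>2) / (50 * d) * ((1 - (cmod z)\<^sup>2) / m\<^sup>2) \<le> 1 / 25 * ((1 - (cmod z)\<^sup>2) / m\<^sup>2)"
      using z2 by (intro mult_right_mono) auto
    moreover have "disc_kernel (exp w) z = (1 - (cmod (exp w))\<^sup>2) * (1 - (cmod z)\<^sup>2) / m\<^sup>2"
      by (simp add: disc_kernel_def m_def)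
    ultimately show ?thesis by (simp add: power_mult_distrib mult_ac)
  qed
  ultimately show ?thesis by (simp add: d_def \<zeta>_def)
qed

text \<open>The discs meet the imaginary axis in disjoint intervals, which are the
  \<open>I w\<close> in units of \<open>2 \<pi>\<close>. On \<open>I w\<close> the Poisson kernel is
  at least the constant \<open>c w\<close>, and the resulting step function has as integral the sum
  of the kernels divided by \<open>50 \<pi>\<close>. Comparison with the integral 3 gives the bound
  \<open>150 \<pi> < 600\<close>.\<close>

lemma sum_disc_kernel_bound:
  assumes "finite X" and X: "\<And>w. w \<in> X \<Longrightarrow> -1 \<le> Re w \<and> Re w < 0 \<and> 0 \<le> Im w \<and> Im w < 2 * pi"
    and disj: "pairwise (\<lambda>v w. disjnt (cball (\<i> * of_real (Im v)) (- Re v)) (cball (\<i> * of_real (Im w)) (- Re w))) X"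
    and z: "cmod z < 1"
  shows "(\<Sum>w\<in>X. disc_kernel (exp w) z) \<le> 600"
proof -
  define P where "P = (\<lambda>t::real. (1 - (cmod z)\<^sup>2) / (cmod (exp (2 * of_real pi * \<i> * of_real t) - z))\<^sup>2)"
  define I where "I = (\<lambda>w. {(Im w + Re w) / (2 * pi) .. (Im w - Re w) / (2 * pi)})"
  define c where "c = (\<lambda>w. disc_kernel (exp w) z / (50 * (- Re w)))"
  have P0: "0 \<le> P t" for t using z by (simp add: P_def abs_square_le_1)
  have pi1: "1 \<le> 2 * pi" using pi_gt3 by simp
  have inI: "t \<in> I w \<longleftrightarrow> \<bar>2 * pi * t - Im w\<bar> \<le> - Re w" if "w \<in> X" for t w
    using X[OF that] by (auto simp: I_def field_simps)
  have cP: "c w \<le> P t" if "w \<in> X" "t \<in> I w" for w t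
    using disc_kernel_le_Poisson_kernel[of w z "2 * pi * t"] X[OF that(1)] z inI[of w t] that
    by (simp add: c_def P_def mult_ac)
  have unique: "v = w" if "v \<in> X" "w \<in> X" "t \<in> I v" "t \<in> I w" for v w t
  proof (rule ccontr)
    assume "v \<noteq> w"
    have "\<i> * of_real (2 * pi * t) \<in> cball (\<i> * of_real (Im x)) (- Re x)" if "x \<in> X" "t \<in> I x" for x
    proof -
      have "dist (\<i> * of_real (Im x)) (\<i> * of_real (2 * pi * t)) = \<bar>2 * pi * t - Im x\<bar>"
        unfolding dist_norm by (simp add: cmod_def abs_minus_commute)
      then show ?thesis using inI[of x t] that by simp
    qed
    then show False using disj that \<open>v \<noteq> w\<close> unfolding pairwise_def disjnt_iff by blast
  qed
  have le: "(\<Sum>w\<in>X. if t \<in> I w then c w else 0) \<le> P t" for t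
  proof (cases "\<exists>w\<in>X. t \<in> I w")
    case True
    then obtain w where w: "w \<in> X" "t \<in> I w" by blast
    have "(\<Sum>v\<in>X. if t \<in> I v then c v else 0) = (\<Sum>v\<in>X. if v = w then c v else 0)"
      by (intro sum.cong refl) (use unique w in auto)
    then show ?thesis using w cP assms(1) by simp
  next
    case False
    then have "(\<Sum>v\<in>X. if t \<in> I v then c v else 0) = 0" by (intro sum.neutral) auto
    then show ?thesis using P0 by simp
  qed
  have "((\<lambda>t. \<Sum>w\<in>X. if t \<in> I w then c w else 0) has_integral (\<Sum>w\<in>X. disc_kernel (exp w) z / (50 * pi))) {-1..2}"
  proof (rule has_integral_sum[OF assms(1)])
    fix w assume w: "w \<in> X"
    have sub: "I w \<subseteq> {-1..2}"
      using X[OF w] pi1 by (auto simp: I_def field_simps)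
    have "((\<lambda>t. c w) has_integral ((Im w - Re w) / (2 * pi) - (Im w + Re w) / (2 * pi)) *\<^sub>R c w) (I w)"
      unfolding I_def by (rule has_integral_const_real[THEN has_integral_eq_rhs]) (use X[OF w] in \<open>auto simp: divide_right_mono\<close>)
    also have "((Im w - Re w) / (2 * pi) - (Im w + Re w) / (2 * pi)) *\<^sub>R c w = disc_kernel (exp w) z / (50 * pi)"
      using X[OF w] by (simp add: c_def field_simps)
    finally show "((\<lambda>t. if t \<in> I w then c w else 0) has_integral disc_kernel (exp w) z / (50 * pi)) {-1..2}"
      using sub by (simp add: has_integral_restrict)
  qed
  from has_integral_le[OF this Poisson_kernel_has_integral_three[OF z, folded P_def] le]
  have "(\<Sum>w\<in>X. disc_kernel (exp w) z) / (50 * pi) \<le> 3" by (simp add: sum_divide_distrib)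
  then have "(\<Sum>w\<in>X. disc_kernel (exp w) z) \<le> 150 * pi" by (simp add: field_simps)
  then show ?thesis using pi_less_4 by simp
qed

subsection \<open>The triangles and their area\<close>

lemma abs_Arg_le_pi_quarter_iff:
  assumes "z \<noteq> 0"
  shows "\<bar>Arg z\<bar> \<le> pi / 4 \<longleftrightarrow> \<bar>Im z\<bar> \<le> Re z"
proof -
  define a where "a = \<bar>Arg z\<bar>"
  have a: "0 \<le> a" "a \<le> pi" using Arg_bounded[of z] by (auto simp: a_def)
  have eq: "z = rcis (cmod z) (Arg z)" by (simp add: rcis_cmod_Arg)
  have ca: "cos a = cos (Arg z)" by (simp add: a_def abs_if)
  have sa: "sin a = \<bar>sin (Arg z)\<bar>"
  proof -
    have "sin a \<ge> 0" using a by (intro sin_ge_zero) auto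
    then show ?thesis by (auto simp: a_def abs_if split: if_splits)
  qed
  have "Re z = cmod z * cos a" "\<bar>Im z\<bar> = cmod z * sin a"
    using arg_cong[OF eq, of Re] arg_cong[OF eq, of Im] ca sa by (auto simp: abs_mult)
  then have 1: "\<bar>Im z\<bar> \<le> Re z \<longleftrightarrow> sin a \<le> cos a" using assms by simp
  have "sin a \<le> cos a \<longleftrightarrow> a \<le> pi / 4"
  proof
    assume le: "a \<le> pi / 4"
    have "sin a \<le> sin (pi / 4)" using le a by (intro sin_monotone_2pi_le) auto
    also have "\<dots> = cos (pi / 4)" by (simp add: sin_45 cos_45)
    also have "\<dots> \<le> cos a" using le a by (intro cos_monotone_0_pi_le) auto
    finally show "sin a \<le> cos a" .
  next
    assume le: "sin a \<le> cos a"
    show "a \<le> pi / 4"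
    proof (rule ccontr)
      assume "\<not> a \<le> pi / 4"
      then have g: "pi / 4 < a" by simp
      have "cos a < cos (pi / 4)" using g a by (intro cos_monotone_0_pi) auto
      also have "\<dots> = sin (pi / 4)" by (simp add: sin_45 cos_45)
      finally have c: "cos a < sin (pi / 4)" .
      show False
      proof (cases "a \<le> pi / 2")
        case True
        have "sin (pi / 4) < sin a" using g True by (intro sin_monotone_2pi) auto
        with c le show False by simp
      next
        case False
        have "cos a < cos (pi / 2)" using False a by (intro cos_monotone_0_pi) auto
        moreover have "0 \<le> sin a" using a by (intro sin_ge_zero) auto
        ultimately show False using le by simp
      qed
    qed
  qed
  then show ?thesis using 1 by (simp add: a_def)
qed

text \<open>Replaces \<open>Arg\<close> by linear inequalities, the form in which the triangles are
  used from here on.\<close>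

lemma mem_triangle_iff:
  assumes "Re v < 0"
  shows "w \<in> triangle v \<longleftrightarrow> Re w \<le> 0 \<and> \<bar>Im w - Im v\<bar> \<le> Re w - Re v"
  using assms abs_Arg_le_pi_quarter_iff[of "w - v"] by (auto simp: triangle_def)

text \<open>A triangle of depth \<open>d\<close> lies in the disc of radius \<open>d\<close> about
  the projection of its vertex to the imaginary axis, because \<open>Re w (Re w + d) \<le> 0\<close>
  on it.\<close>

lemma dist_imaginary_axis_le:
  assumes "\<bar>Im w - y\<bar> \<le> Re w + d" "Re w \<le> 0"
  shows "dist (\<i> * of_real y) w \<le> d"
proof -
  have "0 \<le> \<bar>Im w - y\<bar>" by simp
  then have "0 \<le> Re w + d" using assms by linarith
  have "(Im w - y)\<^sup>2 \<le> (Re w + d)\<^sup>2" using assms by (metis abs_le_square_iff abs_ge_self order_trans)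
  also have "(Re w + d)\<^sup>2 + (Re w)\<^sup>2 \<le> d\<^sup>2"
  proof -
    have "Re w * (Re w + d) \<le> 0" using assms \<open>0 \<le> Re w + d\<close> by (simp add: mult_nonpos_nonneg)
    then show ?thesis by (simp add: power2_eq_square algebra_simps)
  qed
  finally have "(dist (\<i> * of_real y) w)\<^sup>2 \<le> d\<^sup>2"
    by (simp add: dist_norm cmod_power2 power2_commute)
  moreover have "0 \<le> d" using assms \<open>0 \<le> Re w + d\<close> by linarith
  ultimately show ?thesis by (rule power2_le_imp_le)
qed

lemma measure_lebesgue_cbox_complex:
  assumes "a \<le> b" "c \<le> d"
  shows "measure lebesgue (cbox (Complex a c) (Complex b d)) = (b - a) * (d - c)"
proof -
  have "measure lebesgue (cbox (Complex a c) (Complex b d)) = (\<Prod>i\<in>Basis. (Complex b d - Complex a c) \<bullet> i)"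
    using assms by (subst measure_completion) (auto simp: measure_lborel_cbox_eq Basis_complex_def)
  also have "\<dots> = (b - a) * (d - c)" by (simp add: Basis_complex_def complex_eq_iff)
  finally show ?thesis .
qed

lemma measure_lebesgue_cball_complex:
  assumes "0 \<le> r"
  shows "measure lebesgue (cball (c::complex) r) = pi * r\<^sup>2"
  using assms by (subst measure_completion) (auto simp: content_cball unit_ball_vol_2)

section \<open>Obstacles, their shadow in a fundamental strip, and the comparison of areas\<close>

locale punctured_disc_region =
  fixes U :: "complex set"
  assumes open_U: "open U" and U_sub: "U \<subseteq> ball 0 1" and zero_U: "0 \<in> U"
begin

definition obst :: "complex set" where
  "obst = {w. exp w \<in> ball 0 1 - U}"

definition strip :: "complex set" where
  "strip = {w. 0 \<le> Im w \<and> Im w < 2 * pi}"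

text \<open>Representatives in the strip of the image of \<open>A\<close> in the cylinder; by
  periodicity its measure is the cylinder area (\<open>cyl_area_eq\<close>).\<close>

definition shadow :: "complex set" where
  "shadow = strip \<inter> triangle_union U"

lemma obst_Re: "w \<in> obst \<Longrightarrow> Re w < 0"
  by (simp add: obst_def)

lemma obst_periodic: "w \<in> obst \<Longrightarrow> w + 2 * of_real pi * \<i> * of_int k \<in> obst"
proof -
  have "exp (w + 2 * of_real pi * \<i> * of_int k) = exp w"
    using exp_integer_2pi[of "of_int k"] by (simp add: exp_add mult_ac)
  then show "w \<in> obst \<Longrightarrow> w + 2 * of_real pi * \<i> * of_int k \<in> obst" by (simp add: obst_def)
qed

lemma mem_triangle_union_iff:
  "w \<in> triangle_union U \<longleftrightarrow> Re w \<le> 0 \<and> (\<exists>v\<in>obst. \<bar>Im w - Im v\<bar> \<le> Re w - Re v)"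
proof -
  have "w \<in> triangle_union U \<longleftrightarrow> (\<exists>v\<in>obst. w \<in> triangle v)"
    by (auto simp: triangle_union_def obst_def)
  also have "\<dots> \<longleftrightarrow> (\<exists>v\<in>obst. Re w \<le> 0 \<and> \<bar>Im w - Im v\<bar> \<le> Re w - Re v)"
    using mem_triangle_iff obst_Re by auto
  finally show ?thesis by blast
qed

lemma triangle_union_periodic:
  assumes "w \<in> triangle_union U"
  shows "w + 2 * of_real pi * \<i> * of_int k \<in> triangle_union U"
proof -
  obtain v where v: "v \<in> obst" "\<bar>Im w - Im v\<bar> \<le> Re w - Re v" "Re w \<le> 0"
    using assms by (auto simp: mem_triangle_union_iff)
  then show ?thesis
    unfolding mem_triangle_union_iff
    using obst_periodic[OF v(1), of k] by (auto intro!: bexI[of _ "v + 2 * of_real pi * \<i> * of_int k"])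
qed

lemma cyl_area_eq: "cyl_area (cyl_proj ` triangle_union U) = measure lebesgue shadow"
proof -
  have "cyl_proj w \<in> cyl_proj ` triangle_union U \<longleftrightarrow> w \<in> triangle_union U" for w
  proof
    assume "cyl_proj w \<in> cyl_proj ` triangle_union U"
    then obtain v where v: "v \<in> triangle_union U" "cyl_proj w = cyl_proj v" by auto
    have "w \<in> cyl_proj w" unfolding cyl_proj_def by (rule range_eqI[of _ _ 0]) simp
    then obtain k where "w = v + 2 * of_real pi * \<i> * of_int k" unfolding v(2) by (auto simp: cyl_proj_def)
    then show "w \<in> triangle_union U" using triangle_union_periodic[OF v(1)] by simp
  qed auto
  then show ?thesis by (simp add: cyl_area_def shadow_def strip_def Int_def conj_assoc)
qed

lemma obst_bounded: obtains M where "0 < M" "\<And>w. w \<in> obst \<Longrightarrow> - M \<le> Re w"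
proof -
  obtain e where e: "0 < e" "ball 0 e \<subseteq> U" using open_U zero_U open_contains_ball by blast
  show thesis
  proof
    show "0 < \<bar>ln e\<bar> + 1" by simp
    fix w assume "w \<in> obst"
    then have "exp w \<notin> U" by (simp add: obst_def)
    then have "\<not> cmod (exp w) < e" using e(2) by (meson mem_ball_0 subsetD)
    then have "e \<le> exp (Re w)" by simp
    then have "ln e \<le> Re w" using e by (metis exp_gt_zero ln_exp ln_le_cancel_iff)
    then show "- (\<bar>ln e\<bar> + 1) \<le> Re w" by simp
  qed
qed

text \<open>\<open>T\<close> is the sum of the closed set \<open>F\<close> and the cone
  \<open>K\<close>, truncated at the maximal depth \<open>M\<close>; a compact plus a closed set is
  closed. Points of \<open>F\<close> outside the open left half-plane are harmless, since adding
  elements of \<open>K\<close> never moves them into it.\<close>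

lemma closed_cone_over_obst:
  assumes "\<And>w. w \<in> obst \<Longrightarrow> - M \<le> Re w"
  shows "\<exists>T. closed T \<and> (\<forall>w. Re w < 0 \<longrightarrow> (w \<in> T \<longleftrightarrow> w \<in> triangle_union U))"
proof -
  define F where "F = exp -` (- U)"
  define K where "K = {w. \<bar>Im w\<bar> \<le> Re w \<and> Re w \<le> M}"
  have F: "closed F"
    unfolding F_def by (intro closed_vimage) (use open_U in \<open>auto intro!: continuous_intros\<close>)
  have FO: "w \<in> F \<longleftrightarrow> w \<in> obst" if "Re w < 0" for w
    using that by (auto simp: F_def obst_def)
  have "closed K"
    unfolding K_def by (intro closed_Collect_conj closed_Collect_le continuous_intros)
  moreover have "bounded K"
  proof (rule boundedI)
    fix w assume "w \<in> K"
    then show "norm w \<le> 2 * M" using cmod_le[of w] by (auto simp: K_def)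
  qed
  ultimately have "compact K" by (simp add: compact_eq_bounded_closed)
  then have cl: "closed (\<Union>x\<in>K. \<Union>y\<in>F. {x + y})" using F by (rule compact_closed_sums)
  have "w \<in> (\<Union>x\<in>K. \<Union>y\<in>F. {x + y}) \<longleftrightarrow> w \<in> triangle_union U" if w: "Re w < 0" for w
  proof
    assume "w \<in> (\<Union>x\<in>K. \<Union>y\<in>F. {x + y})"
    then obtain x y where xy: "x \<in> K" "y \<in> F" "w = x + y" by auto
    have "0 \<le> Re x" using xy(1) abs_ge_zero[of "Im x"] by (auto simp: K_def)
    then have "Re y < 0" using w xy by simp
    then show "w \<in> triangle_union U"
      unfolding mem_triangle_union_iff using w xy FO[of y] by (intro conjI bexI[of _ y]) (auto simp: K_def)
  next
    assume "w \<in> triangle_union U"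
    then obtain v where v: "v \<in> obst" "\<bar>Im w - Im v\<bar> \<le> Re w - Re v"
      by (auto simp: mem_triangle_union_iff)
    then have "w - v \<in> K" using assms[OF v(1)] w by (auto simp: K_def)
    moreover have "v \<in> F" using FO obst_Re v by blast
    ultimately show "w \<in> (\<Union>x\<in>K. \<Union>y\<in>F. {x + y})"
      by (intro UN_I[of "w - v"] UN_I[of v]) auto
  qed
  with cl show ?thesis by blast
qed

lemma shadow_subset:
  assumes "\<And>w. w \<in> obst \<Longrightarrow> - M \<le> Re w"
  shows "shadow \<subseteq> cbox (Complex (- M) 0) (Complex 0 (2 * pi))"
proof
  fix w assume "w \<in> shadow"
  then obtain v where v: "v \<in> obst" "\<bar>Im w - Im v\<bar> \<le> Re w - Re v" "Re w \<le> 0" "0 \<le> Im w" "Im w < 2 * pi"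
    by (auto simp: shadow_def strip_def mem_triangle_union_iff)
  then have "- M \<le> Re w" using assms[OF v(1)] abs_ge_zero[of "Im w - Im v"] by linarith
  then show "w \<in> cbox (Complex (- M) 0) (Complex 0 (2 * pi))"
    using v by (simp add: in_cbox_complex_iff)
qed

text \<open>Left of the imaginary axis the shadow is Borel by \<open>closed_cone_over_obst\<close>;
  on the axis, about which that lemma says nothing, it is a null set.\<close>

lemma shadow_lmeasurable: "shadow \<in> lmeasurable"
proof -
  obtain M where M: "0 < M" "\<And>w. w \<in> obst \<Longrightarrow> - M \<le> Re w" using obst_bounded by blast
  obtain T where T: "closed T" "\<And>w. Re w < 0 \<Longrightarrow> w \<in> T \<longleftrightarrow> w \<in> triangle_union U"
    using closed_cone_over_obst[OF M(2)] by blast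
  have eq: "shadow = (strip \<inter> {w. Re w < 0} \<inter> T) \<union> (shadow \<inter> {w. Re w = 0})"
    using T(2) by (auto simp: shadow_def mem_triangle_union_iff less_le)
  have "strip = {w. 0 \<le> Im w} \<inter> {w. Im w < 2 * pi}" by (auto simp: strip_def)
  then have "strip \<in> sets borel"
    by (metis borel_closed borel_open closed_halfspace_Im_ge open_halfspace_Im_lt sets.Int)
  moreover have "{w. Re w < 0} \<in> sets borel" 
    by (intro borel_open open_halfspace_Re_lt)
  ultimately have 1: "strip \<inter> {w. Re w < 0} \<inter> T \<in> sets lebesgue"
    using T(1) by (intro sets_completionI_sets) (auto intro: borel_closed)
  have "negligible {w::complex. 1 \<bullet> w = 0}"
    by (rule negligible_hyperplane) auto
  then have "negligible (shadow \<inter> {w. Re w = 0})"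
    by (rule negligible_subset) auto
  then have "shadow \<inter> {w. Re w = 0} \<in> sets lebesgue" by (rule negligible_imp_sets)
  with 1 have "shadow \<in> sets lebesgue" by (subst eq) (rule sets.Un)
  moreover have "bounded shadow"
    using shadow_subset[OF M(2)] bounded_cbox bounded_subset by blast
  ultimately show ?thesis by (simp add: bounded_set_imp_lmeasurable)
qed

lemma measure_shadow_le:
  assumes "\<And>w. w \<in> obst \<Longrightarrow> - M \<le> Re w" "0 \<le> M"
  shows "measure lebesgue shadow \<le> 2 * pi * M"
proof -
  have "measure lebesgue shadow \<le> measure lebesgue (cbox (Complex (- M) 0) (Complex 0 (2 * pi)))"
    by (rule measure_mono_fmeasurable[OF shadow_subset[OF assms(1)]]) (use shadow_lmeasurable in auto)
  also have "\<dots> = 2 * pi * M" using assms by (subst measure_lebesgue_cbox_complex) auto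
  finally show ?thesis .
qed

lemma shadow_contains_box:
  assumes w: "w \<in> obst" "w \<in> strip" and s: "0 \<le> s" "s \<le> - Re w / 2" "s \<le> 1"
  obtains B where "B \<in> lmeasurable" "B \<subseteq> shadow" "measure lebesgue B = s * (- Re w) / 2"
    "B \<subseteq> cball (\<i> * of_real (Im w)) (- Re w)"
proof -
  \<comment> \<open>The box extends upwards from height \<open>Im w\<close> in the lower half of the
    strip and downwards in the upper half; as \<open>s \<le> 1 < \<pi>\<close>, it stays in the
    strip.\<close>
  define y where "y = (if Im w \<le> pi then Im w else Im w - s)"
  define B where "B = cbox (Complex (Re w / 2) y) (Complex 0 (y + s))"
  have r: "Re w < 0" using obst_Re w by blast
  have st: "0 \<le> Im w" "Im w < 2 * pi" using w by (auto simp: strip_def)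
  have B: "Re w / 2 \<le> Re v \<and> Re v \<le> 0 \<and> \<bar>Im v - Im w\<bar> \<le> s \<and> v \<in> strip" if "v \<in> B" for v
    using that s st pi_gt3 by (auto simp: B_def in_cbox_complex_iff y_def strip_def split: if_splits)
  show thesis
  proof
    show "B \<in> lmeasurable" by (simp add: B_def)
    show "measure lebesgue B = s * (- Re w) / 2"
      unfolding B_def using s r by (subst measure_lebesgue_cbox_complex) auto
    show "B \<subseteq> shadow"
    proof
      fix v assume "v \<in> B"
      from B[OF this] show "v \<in> shadow"
        using w s by (auto simp: shadow_def mem_triangle_union_iff intro!: bexI[of _ w])
    qed
    show "B \<subseteq> cball (\<i> * of_real (Im w)) (- Re w)"
    proof
      fix v assume "v \<in> B"
      from B[OF this] show "v \<in> cball (\<i> * of_real (Im w)) (- Re w)"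
        using dist_imaginary_axis_le[of v "Im w" "- Re w"] s by auto
    qed
  qed
qed

text \<open>With \<open>d = - Re w\<close>, a box of height \<open>d / 2\<close> and area
  \<open>d\<^sup>2 / 4\<close> fits into both the shadow and the disc of \<open>w\<close>; disjoint
  discs make the boxes disjoint.\<close>

lemma sum_power2_le_measure_shadow:
  assumes "finite X" "X \<subseteq> obst \<inter> strip" and small: "\<And>w. w \<in> X \<Longrightarrow> - 1 \<le> Re w"
    and disj: "pairwise (\<lambda>v w. disjnt (cball (\<i> * of_real (Im v)) (- Re v)) (cball (\<i> * of_real (Im w)) (- Re w))) X"
  shows "(\<Sum>w\<in>X. (Re w)\<^sup>2) \<le> 4 * measure lebesgue shadow"
proof -
  have "\<exists>B. B \<in> lmeasurable \<and> B \<subseteq> shadow \<and> measure lebesgue B = (Re w)\<^sup>2 / 4 \<and> B \<subseteq> cball (\<i> * of_real (Im w)) (- Re w)"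
    if "w \<in> X" for w
  proof -
    have w: "w \<in> obst" "w \<in> strip" "- 1 \<le> Re w" "Re w < 0" using that assms(2) small obst_Re by auto
    obtain B where B: "B \<in> lmeasurable" "B \<subseteq> shadow" "measure lebesgue B = (- Re w / 2) * (- Re w) / 2"
        "B \<subseteq> cball (\<i> * of_real (Im w)) (- Re w)"
      by (rule shadow_contains_box[OF w(1,2), of "- Re w / 2"]) (use w in auto)
    have "(- Re w / 2) * (- Re w) / 2 = (Re w)\<^sup>2 / 4" by (simp add: power2_eq_square)
    then show ?thesis using B by metis
  qed
  then obtain B where B: "\<And>w. w \<in> X \<Longrightarrow> B w \<in> lmeasurable" "\<And>w. w \<in> X \<Longrightarrow> B w \<subseteq> shadow"
    "\<And>w. w \<in> X \<Longrightarrow> measure lebesgue (B w) = (Re w)\<^sup>2 / 4" "\<And>w. w \<in> X \<Longrightarrow> B w \<subseteq> cball (\<i> * of_real (Im w)) (- Re w)"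
    by metis
  have dj: "disjoint_family_on B X"
    unfolding disjoint_family_on_def
  proof (intro ballI impI)
    fix v w assume vw: "v \<in> X" "w \<in> X" "v \<noteq> w"
    then have "disjnt (cball (\<i> * of_real (Im v)) (- Re v)) (cball (\<i> * of_real (Im w)) (- Re w))"
      using disj by (auto simp: pairwise_def)
    then show "B v \<inter> B w = {}" using B(4)[OF vw(1)] B(4)[OF vw(2)] unfolding disjnt_def by blast
  qed
  have "(\<Sum>w\<in>X. (Re w)\<^sup>2) / 4 = (\<Sum>w\<in>X. measure lebesgue (B w))"
    by (simp add: B(3) sum_divide_distrib)
  also have "\<dots> = measure lebesgue (\<Union>w\<in>X. B w)"
    by (rule measure_UNION'[symmetric]) 
       (use assms(1) B(1) dj in \<open>auto simp: disjoint_family_on_def pairwise_def disjnt_def\<close>)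
  also have "\<dots> \<le> measure lebesgue shadow"
    by (rule measure_mono_fmeasurable) (use B assms(1) shadow_lmeasurable in \<open>auto intro!: sets.finite_UN\<close>)
  finally show ?thesis by simp
qed

text \<open>Vitali's lemma for the discs of the obstacles in the strip, whose radii are at most 1;
  each triangle lies in its disc. The covering by arbitrary translates serves the lower bound for
  the radius. The one by three translates bounds the area of the shadow.\<close>

lemma Vitali_obst:
  assumes small: "\<And>w. w \<in> obst \<Longrightarrow> - 1 \<le> Re w"
  obtains C where "countable C" "C \<subseteq> obst \<inter> strip"
    "pairwise (\<lambda>v w. disjnt (cball (\<i> * of_real (Im v)) (- Re v)) (cball (\<i> * of_real (Im w)) (- Re w))) C"
    "\<And>w. w \<in> triangle_union U \<Longrightarrow> \<exists>c\<in>C. \<exists>k::int. dist (\<i> * of_real (Im c)) (w + 2 * of_real pi * \<i> * of_int k) \<le> 5 * (- Re c)"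
    "\<And>w. w \<in> shadow \<Longrightarrow> \<exists>c\<in>C. \<exists>k\<in>{-1,0,1::int}. dist (\<i> * of_real (Im c)) (w + 2 * of_real pi * \<i> * of_int k) \<le> 5 * (- Re c)"
proof -
  define a where "a = (\<lambda>w. \<i> * of_real (Im w))"
  define r where "r = (\<lambda>w. - Re w)"
  define K where "K = obst \<inter> strip"
  have rK: "\<And>w. w \<in> K \<Longrightarrow> 0 < r w \<and> r w \<le> 1" using obst_Re small by (auto simp: K_def r_def)
  obtain C where C: "countable C" "C \<subseteq> K"
     "pairwise (\<lambda>i j. disjnt (cball (a i) (r i)) (cball (a j) (r j))) C"
     "(\<Union>w\<in>K. cball (a w) (r w)) \<subseteq> (\<Union>i\<in>C. cball (a i) (5 * r i))"
    by (rule Vitali_covering_lemma_cballs[OF order_refl rK])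
  have main: "\<exists>c\<in>C. \<exists>k::int. (dist (a c) (w + 2 * of_real pi * \<i> * of_int k) \<le> 5 * r c \<and> (w \<in> strip \<longrightarrow> k \<in> {-1,0,1}))"
    if w: "w \<in> triangle_union U" for w
  proof -
    obtain v where v: "v \<in> obst" "\<bar>Im w - Im v\<bar> \<le> Re w - Re v" "Re w \<le> 0"
      using w by (auto simp: mem_triangle_union_iff)
    \<comment> \<open>The translation that brings the vertex \<open>v\<close> into the strip;
      \<open>w\<close> is moved along with it.\<close>
    define k where "k = - \<lfloor>Im v / (2 * pi)\<rfloor>"
    define v' where "v' = v + 2 * of_real pi * \<i> * of_int k"
    define w' where "w' = w + 2 * of_real pi * \<i> * of_int k"
    have Imv': "Im v' = Im v + 2 * pi * of_int k" "Im w' = Im w + 2 * pi * of_int k" "Re v' = Re v" "Re w' = Re w"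
      by (auto simp: v'_def w'_def)
    have vs: "v' \<in> strip"
    proof -
      have "- of_int k \<le> Im v / (2 * pi)" "Im v / (2 * pi) < - of_int k + 1"
        by (auto simp: k_def) 
      then have "- of_int k * (2 * pi) \<le> Im v" "Im v < (- of_int k + 1) * (2 * pi)"
        by (simp_all add: pos_le_divide_eq pos_divide_less_eq)
      then show ?thesis by (simp add: strip_def Imv' algebra_simps)
    qed
    have "v' \<in> obst" unfolding v'_def by (rule obst_periodic[OF v(1)])
    then have "v' \<in> K" using vs by (simp add: K_def)
    moreover have "w' \<in> cball (a v') (r v')"
      using dist_imaginary_axis_le[of w' "Im v'" "- Re v'"] v by (simp add: a_def r_def Imv')
    ultimately have "w' \<in> (\<Union>i\<in>C. cball (a i) (5 * r i))" using C(4) by blast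
    then obtain c where c: "c \<in> C" "dist (a c) w' \<le> 5 * r c" by auto
    \<comment> \<open>The heights of \<open>w\<close> and \<open>v\<close> differ by at most 1, so
      for \<open>w\<close> in the strip the translation is shorter than two periods.\<close>
    have "k \<in> {-1,0,1}" if "w \<in> strip"
    proof -
      have "\<bar>Im w - Im v\<bar> \<le> 1" using v small[OF v(1)] by linarith
      then have "\<bar>2 * pi * of_int k\<bar> < 2 * pi + 1" using vs that by (auto simp: strip_def Imv')
      moreover have "\<bar>2 * pi * of_int k\<bar> = 2 * pi * \<bar>of_int k\<bar>" by (simp add: abs_mult)
      ultimately have "2 * pi * \<bar>of_int k\<bar> < 2 * pi * 2" using pi_gt3 by linarith
      then have "\<bar>real_of_int k\<bar> < 2" by simp
      then have "\<bar>k\<bar> < 2" by linarith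
      then show ?thesis by auto
    qed
    with c show ?thesis by (auto simp: w'_def)
  qed
  show thesis
  proof (rule that[OF C(1) _ C(3)[unfolded a_def r_def]])
    show "C \<subseteq> obst \<inter> strip" using C(2) by (simp add: K_def)
    show "\<exists>c\<in>C. \<exists>k::int. dist (\<i> * of_real (Im c)) (w + 2 * of_real pi * \<i> * of_int k) \<le> 5 * (- Re c)"
      if "w \<in> triangle_union U" for w
      using main[OF that] by (auto simp: a_def r_def)
    show "\<exists>c\<in>C. \<exists>k\<in>{-1,0,1::int}. dist (\<i> * of_real (Im c)) (w + 2 * of_real pi * \<i> * of_int k) \<le> 5 * (- Re c)"
      if "w \<in> shadow" for w
      using main[of w] that unfolding shadow_def a_def r_def by blast
  qed
qed

text \<open>Each \<open>c\<close> contributes three discs of radius \<open>5 d\<close>,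
  \<open>d = - Re c\<close>, of total area \<open>75 \<pi> d\<^sup>2\<close>; the bound for finite
  subfamilies passes to the countable union.\<close>

lemma measure_shadow_le_sum:
  assumes "countable C"
    and cover: "\<And>w. w \<in> shadow \<Longrightarrow> \<exists>c\<in>C. \<exists>k\<in>{-1,0,1::int}. dist (\<i> * of_real (Im c)) (w + 2 * of_real pi * \<i> * of_int k) \<le> 5 * (- Re c)"
    and B: "\<And>X. finite X \<Longrightarrow> X \<subseteq> C \<Longrightarrow> (\<Sum>c\<in>X. (Re c)\<^sup>2) \<le> B" and neg: "\<And>c. c \<in> C \<Longrightarrow> Re c \<le> 0"
  shows "measure lebesgue shadow \<le> 75 * pi * B"
proof -
  define D where "D = (\<lambda>c. \<Union>k\<in>{-1,0,1::int}. cball (\<i> * of_real (Im c) - 2 * of_real pi * \<i> * of_int k) (5 * (- Re c)))"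
  have D: "D c \<in> lmeasurable" for c
    unfolding D_def by (intro fmeasurable.finite_UN) auto
  have mD: "measure lebesgue (D c) \<le> 75 * pi * (Re c)\<^sup>2" if "c \<in> C" for c
  proof -
    have "measure lebesgue (D c) \<le> (\<Sum>k\<in>{-1,0,1::int}. measure lebesgue (cball (\<i> * of_real (Im c) - 2 * of_real pi * \<i> * of_int k) (5 * (- Re c))))"
      unfolding D_def by (intro measure_UNION_le) auto
    also have "\<dots> = (\<Sum>k\<in>{-1,0,1::int}. 25 * pi * (Re c)\<^sup>2)"
      using neg[OF that] by (intro sum.cong refl, subst measure_lebesgue_cball_complex) (auto simp: power2_eq_square)
    finally show ?thesis by simp
  qed
  have fin: "measure lebesgue (\<Union>c\<in>X. D c) \<le> 75 * pi * B" if X: "finite X" "X \<subseteq> C" for X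
  proof -
    have "measure lebesgue (\<Union>c\<in>X. D c) \<le> (\<Sum>c\<in>X. measure lebesgue (D c))"
      using X D by (intro measure_UNION_le) auto
    also have "\<dots> \<le> (\<Sum>c\<in>X. 75 * pi * (Re c)\<^sup>2)" using X mD by (intro sum_mono) auto
    also have "\<dots> \<le> 75 * pi * B" using B[OF X] by (simp add: sum_distrib_left[symmetric])
    finally show ?thesis .
  qed
  have sub: "shadow \<subseteq> (\<Union>c\<in>C. D c)"
  proof
    fix w assume "w \<in> shadow"
    then obtain c k where ck: "c \<in> C" "k \<in> {-1,0,1::int}" "dist (\<i> * of_real (Im c)) (w + 2 * of_real pi * \<i> * of_int k) \<le> 5 * (- Re c)"
      using cover by blast
    then have "w \<in> cball (\<i> * of_real (Im c) - 2 * of_real pi * \<i> * of_int k) (5 * (- Re c))"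
      by (simp add: dist_norm algebra_simps)
    with ck show "w \<in> (\<Union>c\<in>C. D c)" unfolding D_def by blast
  qed
  have "(\<Union>c\<in>C. D c) \<in> lmeasurable" "measure lebesgue (\<Union>c\<in>C. D c) \<le> 75 * pi * B"
    using fmeasurable_UN_bound[OF assms(1) D fin] measure_UN_bound[OF assms(1) D fin] by auto
  then show ?thesis
    using measure_mono_fmeasurable[OF sub] shadow_lmeasurable by force
qed

end

subsection \<open>Coverings and Riemann maps\<close>

lemma covering_deriv_neq_0:
  assumes cov: "covering_space C p S" and C: "open C" "p holomorphic_on C" and z: "z \<in> C"
  shows "deriv p z \<noteq> 0"
proof -
  have "p z \<in> S" using cov z by (auto simp: covering_space_def)
  then obtain T \<V> where "p z \<in> T" and UV: "\<Union>\<V> = C \<inter> p -` T" 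
        and op: "\<And>W. W \<in> \<V> \<Longrightarrow> openin (top_of_set C) W" 
        and homeV: "\<And>W. W \<in> \<V> \<Longrightarrow> \<exists>q. homeomorphism W T p q"
    using cov unfolding covering_space_def by meson
  then obtain W where W: "W \<in> \<V>" "z \<in> W" using z by blast
  then have "open W" "W \<subseteq> C" using op[OF W(1)] C(1) openin_open_eq by blast+
  moreover have "inj_on p W" by (metis W(1) homeV homeomorphism_def inj_on_inverseI)
  ultimately show ?thesis
    using W C holomorphic_injective_imp_regular holomorphic_on_subset by blast
qed

text \<open>As the disc is simply connected, \<open>f\<close> lifts through the covering to a
  self-map of the disc fixing 0, and the Schwarz lemma applies to the lift. This takes the place of
  monotonicity of the conformal radius.\<close>

lemma covering_deriv_maximal:
  assumes \<phi>: "disc_universal_covering V \<phi>" "\<phi> 0 = 0"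
    and f: "f holomorphic_on ball 0 1" "f \<in> ball 0 1 \<rightarrow> V" "f 0 = 0"
  shows "cmod (deriv f 0) \<le> cmod (deriv \<phi> 0)"
proof -
  have hol\<phi>: "\<phi> holomorphic_on ball 0 1" and cov: "covering_space (ball 0 1) \<phi> V"
    using \<phi> by (auto simp: disc_universal_covering_def)
  obtain g where g: "continuous_on (ball 0 1) g" "g \<in> ball 0 1 \<rightarrow> ball 0 1" "g 0 = 0"
      "\<And>y. y \<in> ball 0 1 \<Longrightarrow> \<phi> (g y) = f y"
  proof (rule covering_space_lift_strong[OF cov, of 0 0 "ball 0 1" f])
    show "simply_connected (ball 0 1 :: complex set)" by (intro convex_imp_simply_connected) simp
    show "locally path_connected (ball 0 1 :: complex set)" by (intro convex_imp_locally_path_connected) simp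
  qed (use \<phi>(2) f holomorphic_on_imp_continuous_on in auto)
  have holg: "g holomorphic_on ball 0 1"
    by (rule covering_space_lift_is_holomorphic[OF cov open_ball hol\<phi> f(1,2) g(2,1,4)])
  have "cmod (deriv g 0) \<le> 1"
    by (rule Schwarz_Lemma(2)[OF holg g(3), where \<xi> = 0]) (use g(2) in auto)
  have "((\<lambda>z. \<phi> (g z)) has_field_derivative deriv \<phi> 0 * deriv g 0) (at 0)"
    by (rule DERIV_chain2) (use g(3) in \<open>auto intro!: holomorphic_derivI[OF hol\<phi>] holomorphic_derivI[OF holg]\<close>)
  then have "(f has_field_derivative deriv \<phi> 0 * deriv g 0) (at 0)"
    by (rule has_field_derivative_transform_within_open[of _ _ _ "ball 0 1"]) (use g(4) in auto)
  then have "deriv f 0 = deriv \<phi> 0 * deriv g 0" by (rule DERIV_imp_deriv)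
  then show ?thesis
    using mult_left_mono[OF \<open>cmod (deriv g 0) \<le> 1\<close>, of "cmod (deriv \<phi> 0)"] by (simp add: norm_mult)
qed

text \<open>For the Riemann map \<open>f z = z h z\<close> of \<open>S\<close>, the quotient
  \<open>exp (- H (f z)) / h z\<close> is holomorphic, and on a suitable circle its modulus is at
  most \<open>exp \<eta>\<close> by the hypothesis on \<open>H\<close>. The maximum principle
  carries this to 0, where \<open>h 0 = deriv f 0\<close>. The loss \<open>\<eta>\<close> makes
  boundary values of \<open>f\<close> unnecessary.\<close>

lemma Riemann_map_deriv_lower_bound:
  assumes S: "open S" "simply_connected S" "0 \<in> S" "S \<subseteq> ball 0 1"
    and H: "H holomorphic_on ball 0 1" "continuous_on (cball 0 1) H"
    and bd: "\<And>w. w \<in> cball 0 1 - S \<Longrightarrow> exp (- Re (H w)) \<le> cmod w" and \<eta>: "0 < \<eta>"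
  obtains f where "f holomorphic_on ball 0 1" "f \<in> ball 0 1 \<rightarrow> S" "f 0 = 0"
    "exp (- Re (H 0) - \<eta>) \<le> cmod (deriv f 0)"
proof -
  have "(1::complex) \<notin> S" using S(4) by auto
  then have ne: "S \<noteq> {}" "S \<noteq> UNIV" using S(3) by auto
  then obtain F G where FG: "F holomorphic_on S" "G holomorphic_on ball 0 1"
      "\<And>z. z \<in> S \<Longrightarrow> F z \<in> ball 0 1 \<and> G (F z) = z" "\<And>z. z \<in> ball 0 1 \<Longrightarrow> G z \<in> S \<and> F (G z) = z"
    using iffD1[OF Riemann_mapping_theorem[of S] conjI[OF S(1,2)]] ne by metis
  have "F 0 \<in> ball 0 1" using FG(3) S(3) by blast
  then obtain p q where pq: "p (F 0) = 0" "p holomorphic_on ball 0 1" "p ` ball 0 1 \<subseteq> ball 0 1"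
       "q holomorphic_on ball 0 1" "q ` ball 0 1 \<subseteq> ball 0 1"
       "\<And>z. z \<in> ball 0 1 \<Longrightarrow> p (q z) = z" "\<And>z. z \<in> ball 0 1 \<Longrightarrow> q (p z) = z"
    using ball_biholomorphism_exists by blast
  define f where "f = G \<circ> q"
  define k where "k = p \<circ> F"
  have holf: "f holomorphic_on ball 0 1"
    unfolding f_def using pq FG by (intro holomorphic_on_compose_gen) auto
  have contk: "continuous_on S k"
    unfolding k_def using pq FG
    by (intro holomorphic_on_imp_continuous_on holomorphic_on_compose_gen[of _ _ _ "ball 0 1"]) auto
  have fS: "f z \<in> S" "k (f z) = z" if "z \<in> ball 0 1" for z
  proof -
    have "q z \<in> ball 0 1" using pq(5) that by blast
    then show "f z \<in> S" "k (f z) = z" using FG(4) pq(6)[OF that] by (simp_all add: f_def k_def)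
  qed
  have k1: "k w \<in> ball 0 1" if "w \<in> S" for w
    unfolding k_def o_def using FG(3)[OF that] pq(3) by blast
  have f0: "f 0 = 0"
    using pq(7)[OF \<open>F 0 \<in> ball 0 1\<close>] FG(3)[OF S(3)] by (simp add: f_def pq(1))
  have injf: "inj_on f (ball 0 1)" using fS(2) by (rule inj_on_inverseI)
  \<comment> \<open>The set where the bound on \<open>|w|\<close> fails even after the loss
    \<open>\<eta>\<close>. It is a compact subset of \<open>S\<close>, so its preimage under
    \<open>f\<close> lies in a disc of radius \<open>\<rho> < 1\<close>, and \<open>f\<close> avoids
    \<open>K\<close> on the circle of radius \<open>\<rho>\<close>.\<close>
  define K where "K = {w \<in> cball 0 1. cmod w \<le> exp (- Re (H w) - \<eta>)}"
  have KS: "K \<subseteq> S"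
  proof
    fix w assume w: "w \<in> K"
    show "w \<in> S"
    proof (rule ccontr)
      assume "w \<notin> S"
      then have "exp (- Re (H w)) \<le> cmod w" using bd w by (auto simp: K_def)
      also have "\<dots> \<le> exp (- Re (H w) - \<eta>)" using w by (simp add: K_def)
      finally show False using \<eta> by simp
    qed
  qed
  have "closed K"
    unfolding K_def
    by (intro continuous_on_closed_Collect_le continuous_intros H closed_cball)
  moreover have "bounded K" by (rule bounded_subset[OF bounded_cball[of 0 1]]) (auto simp: K_def)
  ultimately have "compact K" by (simp add: compact_eq_bounded_closed)
  then have "compact (k ` K)" using contk KS by (intro compact_continuous_image) (auto intro: continuous_on_subset)
  moreover have "k ` K \<subseteq> ball 0 1" using k1 KS by auto
  ultimately obtain \<rho> where \<rho>: "0 < \<rho>" "\<rho> < 1" "k ` K \<subseteq> ball 0 \<rho>"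
  proof (cases "k ` K = {}")
    case True
    then show ?thesis using that[of "1/2"] by auto
  next
    case False
    obtain x where x: "x \<in> k ` K" "\<And>y. y \<in> k ` K \<Longrightarrow> cmod y \<le> cmod x"
      using continuous_attains_sup[OF \<open>compact (k ` K)\<close> False, of cmod] by (auto intro: continuous_intros)
    have "cmod x < 1" using x \<open>k ` K \<subseteq> ball 0 1\<close> by auto
    moreover have "k ` K \<subseteq> ball 0 ((1 + cmod x) / 2)"
    proof
      fix y assume "y \<in> k ` K"
      then have "cmod y \<le> cmod x" by (rule x(2))
      then show "y \<in> ball 0 ((1 + cmod x) / 2)" using \<open>cmod x < 1\<close> by simp
    qed
    moreover have "0 < (1 + cmod x) / 2" using norm_ge_zero[of x] by (simp add: add_pos_nonneg)
    ultimately show ?thesis by (intro that[of "(1 + cmod x) / 2"]) auto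
  qed
  obtain h where h: "h holomorphic_on ball 0 1" "\<And>z. cmod z < 1 \<Longrightarrow> f z = z * h z" "deriv f 0 = h 0"
    using Schwarz3[OF holf f0] by blast
  have df0: "deriv f 0 \<noteq> 0" using holomorphic_injective_imp_regular[OF holf open_ball injf] by simp
  have h0: "h z \<noteq> 0" if "cmod z < 1" for z
  proof (cases "z = 0")
    case True then show ?thesis using df0 h(3) by simp
  next
    case False
    then have "f z \<noteq> f 0" using injf that by (auto simp: inj_on_def)
    then show ?thesis using h(2)[OF that] f0 by auto
  qed
  define N where "N = (\<lambda>z. exp (- H (f z)) / h z)"
  have holN: "N holomorphic_on ball 0 1"
    unfolding N_def using fS(1) S(4) h0
    by (intro holomorphic_intros holomorphic_on_compose_gen[OF holf H(1), unfolded o_def] h) auto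
  have "cmod (N 0) \<le> exp \<eta>"
  proof (rule maximum_modulus_frontier[of N "cball 0 \<rho>"])
    show "N holomorphic_on interior (cball 0 \<rho>)" using holN \<rho> by (auto intro: holomorphic_on_subset)
    show "continuous_on (closure (cball 0 \<rho>)) N"
      using holomorphic_on_imp_continuous_on[OF holN] \<rho> by (auto intro: continuous_on_subset)
    show "bounded (cball 0 \<rho> :: complex set)" by simp
    show "0 \<in> cball 0 \<rho>" using \<rho> by simp
    fix z :: complex assume "z \<in> frontier (cball 0 \<rho>)"
    then have z: "cmod z = \<rho>" using \<rho> by (simp add: frontier_cball)
    then have zb: "z \<in> ball 0 1" using \<rho> by simp
    have "f z \<notin> K"
    proof
      assume "f z \<in> K"
      then have "k (f z) \<in> ball 0 \<rho>" using \<rho>(3) by blast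
      then show False using fS(2)[OF zb] z by simp
    qed
    moreover have "f z \<in> cball 0 1" using fS(1)[OF zb] S(4) by auto
    ultimately have "exp (- Re (H (f z)) - \<eta>) < cmod (f z)" by (simp add: K_def)
    also have "cmod (f z) = \<rho> * cmod (h z)" using h(2) zb z by (simp add: norm_mult)
    also have "\<dots> \<le> 1 * cmod (h z)" using \<rho> by (intro mult_right_mono) auto
    finally have "exp (- Re (H (f z))) / exp \<eta> < cmod (h z)" by (simp add: exp_diff)
    then have "exp (- Re (H (f z))) \<le> exp \<eta> * cmod (h z)" by (simp add: pos_divide_less_eq mult.commute less_imp_le)
    then show "cmod (N z) \<le> exp \<eta>"
      using h0[of z] zb by (simp add: N_def norm_divide pos_divide_le_eq)
  qed
  then have "exp (- Re (H 0)) \<le> exp \<eta> * cmod (deriv f 0)"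
    using h0[of 0] by (simp add: N_def norm_divide f0 pos_divide_le_eq h(3))
  then have "exp (- Re (H 0) - \<eta>) \<le> cmod (deriv f 0)"
    by (simp add: exp_diff pos_divide_le_eq mult.commute)
  then show thesis using that[OF holf _ f0] fS(1) by blast
qed

subsection \<open>Estimates of the conformal radius\<close>

text \<open>The denominator \<open>x\<close> satisfies \<open>Re x \<ge> d\<close> and
  \<open>|x| \<le> d + |\<zeta> - w| \<le> 6 d\<close>, while
  \<open>Re (1 / x) = Re x / |x|\<^sup>2\<close>.\<close>

lemma Re_inverse_barrier_ge:
  assumes d: "0 < d" and w: "cmod w \<le> 1" and \<zeta>: "cmod \<zeta> = 1" "cmod (\<zeta> - w) \<le> 5 * d"
  shows "1 / (36 * d) \<le> Re (1 / (of_real (1 + d) - w * cnj \<zeta>))"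
proof -
  define x where "x = of_real (1 + d) - w * cnj \<zeta>"
  have "Re (w * cnj \<zeta>) \<le> cmod (w * cnj \<zeta>)" by (rule complex_Re_le_cmod)
  also have "\<dots> \<le> 1" using w \<zeta> by (simp add: norm_mult)
  finally have Rx: "d \<le> Re x" by (simp add: x_def)
  have "x = of_real d + (\<zeta> - w) * cnj \<zeta>"
    using \<zeta> complex_norm_square[of \<zeta>] by (simp add: x_def algebra_simps)
  then have "cmod x \<le> cmod (of_real d) + cmod ((\<zeta> - w) * cnj \<zeta>)" by (metis norm_triangle_ineq)
  also have "\<dots> \<le> 6 * d" using d \<zeta> by (simp add: norm_mult)
  finally have "(cmod x)\<^sup>2 \<le> (6 * d)\<^sup>2" by (intro power_mono) auto
  moreover have "0 < cmod x" using Rx d by (metis complex_Re_le_cmod less_le_trans)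
  ultimately have "d / (6 * d)\<^sup>2 \<le> Re x / (cmod x)\<^sup>2" using Rx d by (intro frac_le) auto
  moreover have "Re (1 / x) = Re x / (cmod x)\<^sup>2" by (simp add: Re_divide cmod_power2)
  ultimately show ?thesis using d by (simp add: x_def power2_eq_square)
qed

lemma Re_inverse_barrier_nonneg:
  assumes d: "0 < d" and w: "cmod w \<le> 1" and \<zeta>: "cmod \<zeta> = 1"
  shows "of_real (1 + d) - w * cnj \<zeta> \<noteq> 0" "0 \<le> Re (1 / (of_real (1 + d) - w * cnj \<zeta>))"
proof -
  have "Re (w * cnj \<zeta>) \<le> cmod (w * cnj \<zeta>)" by (rule complex_Re_le_cmod)
  also have "\<dots> \<le> 1" using w \<zeta> by (simp add: norm_mult)
  finally have Rx: "0 < Re (of_real (1 + d) - w * cnj \<zeta>)" using d by simp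
  then show "of_real (1 + d) - w * cnj \<zeta> \<noteq> 0" by (metis less_irrefl zero_complex.sel(1))
  show "0 \<le> Re (1 / (of_real (1 + d) - w * cnj \<zeta>))" using Rx by (simp add: Re_divide)
qed

lemma ln_le_iff:
  fixes x y :: real
  assumes "0 < x"
  shows "ln x \<le> y \<longleftrightarrow> x \<le> exp y"
  using assms by (metis exp_le_cancel_iff exp_ln)

text \<open>Divided by \<open>exp (- \<delta> / 2)\<close>, the claim reads
  \<open>2 \<le> exp (9 \<delta> / 20) + exp (- 11 \<delta> / 20)\<close>. A quadratic lower bound
  for the first term and a linear one for the second suffice when
  \<open>81 \<delta> \<ge> 80\<close>.\<close>

lemma two_sqrt_exp_minus_le:
  fixes \<delta> :: real
  assumes "1 \<le> \<delta>"
  shows "2 * sqrt (exp (- \<delta>)) \<le> exp (- \<delta> / 20) * (1 + exp (- \<delta>))"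
proof -
  have "exp (9 / 20 * \<delta>) \<ge> 1 + 9 / 20 * \<delta> + (9 / 20 * \<delta>)\<^sup>2 / 2"
    by (rule exp_lower_Taylor_quadratic) (use assms in auto)
  moreover have "exp (- (11 / 20) * \<delta>) \<ge> 1 + (- (11 / 20) * \<delta>)" by (rule exp_ge_add_one_self)
  moreover have "\<delta> \<le> \<delta>\<^sup>2" using assms by (simp add: power2_eq_square)
  then have "80 * \<delta> \<le> 81 * \<delta>\<^sup>2" using assms by linarith
  then have "1 / 10 * \<delta> \<le> (9 / 20 * \<delta>)\<^sup>2 / 2" by (simp add: power2_eq_square)
  ultimately have "2 \<le> exp (9 / 20 * \<delta>) + exp (- (11 / 20) * \<delta>)" by simp
  then have "exp (- \<delta> / 2) * 2 \<le> exp (- \<delta> / 2) * (exp (9 / 20 * \<delta>) + exp (- (11 / 20) * \<delta>))"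
    by (intro mult_left_mono) auto
  also have "\<dots> = exp (- \<delta> / 20) * (1 + exp (- \<delta>))"
    unfolding distrib_left exp_add[symmetric] by (simp add: exp_add[symmetric])
  also have "exp (- \<delta> / 2) = sqrt (exp (- \<delta>))"
    by (rule real_sqrt_unique[symmetric]) (auto simp: exp_double[symmetric])
  finally show ?thesis by (simp add: mult.commute)
qed

text \<open>The square root bound at 0, where \<open>b = |exp w|\<close>. The logarithm of the
  result is linear in the depth, which matches the area in the case of deep obstacles.\<close>

lemma deriv_bound_single_omitted_value:
  assumes holf: "f holomorphic_on ball 0 1" and f1: "\<And>z. cmod z < 1 \<Longrightarrow> cmod (f z) < 1" and f0: "f 0 = 0"
    and w: "Re w \<le> - 1" "\<And>z. cmod z < 1 \<Longrightarrow> f z \<noteq> exp w"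
  shows "cmod (deriv f 0) \<le> exp (Re w / 20)"
proof -
  define b where "b = cmod (Moebius_function 0 (exp w) (f 0))"
  have b: "b = exp (Re w)" by (simp add: b_def f0 Moebius_function_simple)
  have "(1 - (cmod 0)\<^sup>2) * cmod (deriv f 0) * (1 + b) \<le> 2 * sqrt b * (1 - (cmod (f 0))\<^sup>2)"
    by (rule Schwarz_Pick_omitted_value[OF holf f1 _ _ w(2) b_def]) (use w(1) in auto)
  then have "cmod (deriv f 0) * (1 + b) \<le> 2 * sqrt b" by (simp add: f0)
  also have "\<dots> \<le> exp (Re w / 20) * (1 + b)"
    using two_sqrt_exp_minus_le[of "- Re w"] w(1) by (simp add: b)
  finally show ?thesis by (simp add: b mult_le_cancel_right add_pos_pos)
qed

section \<open>The starlike core and the lower bound\<close>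

context punctured_disc_region
begin

text \<open>The starlike domain of the overview; 0 is adjoined because it has no logarithm.\<close>

definition core :: "complex set" where
  "core = {0} \<union> exp ` ({w. Re w < 0} - triangle_union U)"

lemma core_subset: "core \<subseteq> U"
proof
  fix z assume "z \<in> core"
  then consider "z = 0" | w where "z = exp w" "Re w < 0" "w \<notin> triangle_union U"
    by (auto simp: core_def)
  then show "z \<in> U"
  proof cases
    case 2
    show ?thesis
    proof (rule ccontr)
      assume "z \<notin> U"
      then have "w \<in> obst" using 2 by (simp add: obst_def)
      then show False using 2 by (auto simp: mem_triangle_union_iff intro: bexI[of _ w])
    qed
  qed (simp add: zero_U)
qed

text \<open>Away from 0 this is the openness of \<open>exp\<close>; near 0 the bounded depth of the
  obstacles puts a whole disc into the core.\<close>

lemma open_core: "open core"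
proof -
  obtain M where M: "0 < M" "\<And>w. w \<in> obst \<Longrightarrow> - M \<le> Re w" using obst_bounded by blast
  obtain T where T: "closed T" "\<And>w. Re w < 0 \<Longrightarrow> w \<in> T \<longleftrightarrow> w \<in> triangle_union U"
    using closed_cone_over_obst[OF M(2)] by blast
  have eq: "{w. Re w < 0} - triangle_union U = {w. Re w < 0} \<inter> - T" using T(2) by auto
  have "open ({w. Re w < 0} - triangle_union U)"
    unfolding eq using T(1) by (intro open_Int open_halfspace_Re_lt) auto
  then have "openin (top_of_set UNIV) ({w. Re w < 0} - triangle_union U)" by simp
  then have "openin (top_of_set (- {0})) (exp ` ({w. Re w < 0} - triangle_union U))"
    by (rule covering_space_open_map[OF covering_space_exp_punctured_plane])
  then have 1: "open (exp ` ({w. Re w < 0} - triangle_union U))"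
    by (rule openin_open_trans) (simp add: open_Compl)
  have "ball 0 (exp (- M)) \<subseteq> core"
  proof
    fix z :: complex assume z: "z \<in> ball 0 (exp (- M))"
    show "z \<in> core"
    proof (cases "z = 0")
      case False
      have "cmod z < exp (- M)" using z by simp
      then have "ln (cmod z) < - M" using False by (metis exp_less_cancel_iff exp_ln zero_less_norm_iff)
      then have r: "Re (Ln z) < - M" using False by simp
      have "Ln z \<notin> triangle_union U"
      proof
        assume "Ln z \<in> triangle_union U"
        then obtain v where v: "v \<in> obst" "\<bar>Im (Ln z) - Im v\<bar> \<le> Re (Ln z) - Re v"
          by (auto simp: mem_triangle_union_iff)
        then show False using M(2)[OF v(1)] r abs_ge_zero[of "Im (Ln z) - Im v"] by linarith
      qed
      then have "exp (Ln z) \<in> core" using r M(1) unfolding core_def by (intro UnI2 imageI) auto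
      then show ?thesis using False by simp
    qed (simp add: core_def)
  qed
  then have "core = ball 0 (exp (- M)) \<union> exp ` ({w. Re w < 0} - triangle_union U)"
    by (auto simp: core_def)
  then show ?thesis using 1 by (metis open_Un open_ball)
qed

text \<open>Moving towards 0 along a radius is moving left in the logarithmic coordinate, and the
  union of triangles is stable under moving right within the left half-plane.\<close>

lemma starlike_core: "starlike core"
  unfolding starlike_def
proof (intro bexI ballI)
  show "0 \<in> core" by (simp add: core_def)
  fix z assume "z \<in> core"
  then consider "z = 0" | w where "z = exp w" "Re w < 0" "w \<notin> triangle_union U"
    by (auto simp: core_def)
  then show "closed_segment 0 z \<subseteq> core"
  proof cases
    case 1
    then show ?thesis by (simp add: core_def)
  next
    case 2
    show ?thesis
    proof
      fix x assume "x \<in> closed_segment 0 z"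
      then obtain t where t: "0 \<le> t" "t \<le> 1" "x = of_real t * z"
        by (auto simp: closed_segment_def scaleR_conv_of_real)
      show "x \<in> core"
      proof (cases "t = 0")
        case False
        define v where "v = w + of_real (ln t)"
        have l: "ln t \<le> 0" using t False by simp
        have "x = exp v" using t False 2 by (simp add: v_def exp_add exp_of_real)
        moreover have "Re v < 0" using l 2 by (simp add: v_def)
        moreover have "v \<notin> triangle_union U"
        proof
          assume "v \<in> triangle_union U"
          then obtain u where "u \<in> obst" "\<bar>Im v - Im u\<bar> \<le> Re v - Re u"
            by (auto simp: mem_triangle_union_iff)
          then have "w \<in> triangle_union U"
            unfolding mem_triangle_union_iff using l 2 by (intro conjI bexI[of _ u]) (auto simp: v_def)
          with 2 show False by simp
        qed
        ultimately show ?thesis by (auto simp: core_def)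
      qed (simp add: core_def t)
    qed
  qed
qed

lemma core_subset_component: "core \<subseteq> connected_component_set U 0"
  by (rule connected_component_maximal[OF _ starlike_imp_connected[OF starlike_core] core_subset])
     (simp add: core_def)

lemma log_not_in_core:
  assumes "w \<in> ball 0 1 - core"
  shows "Ln w \<in> triangle_union U" "w \<noteq> 0"
proof -
  show "w \<noteq> 0" using assms by (auto simp: core_def)
  then have w: "w = exp (Ln w)" "Re (Ln w) < 0" using assms by auto
  show "Ln w \<in> triangle_union U"
  proof (rule ccontr)
    assume "Ln w \<notin> triangle_union U"
    then have "exp (Ln w) \<in> core" using w(2) unfolding core_def by blast
    then show False using w(1) assms by simp
  qed
qed

lemma conformal_radius_lower_small:
  assumes small: "\<And>w. w \<in> obst \<Longrightarrow> - 1 \<le> Re w"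
    and \<phi>: "disc_universal_covering (connected_component_set U 0) \<phi>" "\<phi> 0 = 0"
  shows "exp (- 720 * measure lebesgue shadow) \<le> cmod (deriv \<phi> 0)"
proof -
  define m where "m = measure lebesgue shadow"
  obtain C where C: "countable C" "C \<subseteq> obst \<inter> strip"
    "pairwise (\<lambda>v w. disjnt (cball (\<i> * of_real (Im v)) (- Re v)) (cball (\<i> * of_real (Im w)) (- Re w))) C"
    "\<And>w. w \<in> triangle_union U \<Longrightarrow> \<exists>c\<in>C. \<exists>k::int. dist (\<i> * of_real (Im c)) (w + 2 * of_real pi * \<i> * of_int k) \<le> 5 * (- Re c)"
    by (rule Vitali_obst[OF small]) iprover+
  have Cneg: "Re c < 0" if "c \<in> C" for c using C(2) obst_Re that by blast
  have sum_le: "(\<Sum>c\<in>X. (Re c)\<^sup>2) \<le> 4 * m" if "finite X" "X \<subseteq> C" for X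
    unfolding m_def
    by (rule sum_power2_le_measure_shadow) (use that C small in \<open>auto intro: pairwise_subset\<close>)
  have "exp (- 720 * m - \<epsilon>) \<le> cmod (deriv \<phi> 0)" if \<epsilon>: "0 < \<epsilon>" for \<epsilon>
  proof -
    \<comment> \<open>One \<open>e\<close> is the constant in \<open>H\<close>, the other the loss
      \<open>\<eta>\<close> of the Riemann map.\<close>
    define e where "e = \<epsilon> / 2"
    have e: "0 < e" using \<epsilon> by (simp add: e_def)
    \<comment> \<open>The bounded sum of squares leaves only finitely many large \<open>c\<close>. A
      point covered through a small one satisfies \<open>- Re \<omega> < e\<close>, and the constant
      in \<open>H\<close> takes care of it.\<close>
    define X where "X = {c \<in> C. e / 5 \<le> - Re c}"
    have finX: "finite X"
    proof -
      have "card Y \<le> nat \<lfloor>4 * m / (e / 5)\<^sup>2\<rfloor>" if Y: "Y \<subseteq> X" "finite Y" for Y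
      proof -
        have "real (card Y) * (e / 5)\<^sup>2 = (\<Sum>c\<in>Y. (e / 5)\<^sup>2)" by simp
        also have "\<dots> \<le> (\<Sum>c\<in>Y. (- Re c)\<^sup>2)" using Y e by (intro sum_mono power_mono) (auto simp: X_def)
        also have "\<dots> \<le> 4 * m" using sum_le[of Y] Y by (auto simp: X_def)
        finally have "real (card Y) \<le> 4 * m / (e / 5)\<^sup>2" using e by (simp add: pos_le_divide_eq)
        then show ?thesis by (simp add: le_nat_floor)
      qed
      then show ?thesis using finite_if_finite_subsets_card_bdd by blast
    qed
    \<comment> \<open>The factor 180 is 5 times 36: near its \<open>c\<close> a summand is at least
      \<open>180 d\<^sup>2 / (36 d) = 5 d\<close>, which dominates \<open>- Re \<omega>\<close> on
      the enlarged disc. Having \<open>1 + d\<close> in place of 1 keeps the poles off the closed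
      unit disc.\<close>
    define H where "H = (\<lambda>w. of_real e + (\<Sum>c\<in>X. of_real (180 * (Re c)\<^sup>2) * (1 / (of_real (1 + (- Re c)) - w * cnj (exp (\<i> * of_real (Im c)))))))"
    have nz: "of_real (1 + (- Re c)) - w * cnj (exp (\<i> * of_real (Im c))) \<noteq> 0" if "c \<in> X" "cmod w \<le> 1" for c w
      by (rule Re_inverse_barrier_nonneg) (use Cneg that in \<open>auto simp: X_def\<close>)
    have ReH: "Re (H w) = e + (\<Sum>c\<in>X. 180 * (Re c)\<^sup>2 * Re (1 / (of_real (1 + (- Re c)) - w * cnj (exp (\<i> * of_real (Im c))))))" for w
    proof -
      have "Re (of_real (180 * (Re c)\<^sup>2) * u) = 180 * (Re c)\<^sup>2 * Re u" for c u by simp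
      then show ?thesis unfolding H_def by (simp only: plus_complex.sel Re_sum Re_complex_of_real)
    qed
    have term0: "0 \<le> 180 * (Re c)\<^sup>2 * Re (1 / (of_real (1 + (- Re c)) - w * cnj (exp (\<i> * of_real (Im c)))))"
      if "c \<in> X" "cmod w \<le> 1" for c w
      by (intro mult_nonneg_nonneg Re_inverse_barrier_nonneg(2)) (use Cneg that in \<open>auto simp: X_def\<close>)
    have bd: "exp (- Re (H w)) \<le> cmod w" if w: "w \<in> cball 0 1 - core" for w
    proof -
      have w1: "cmod w \<le> 1" using w by simp
      have sn: "0 \<le> (\<Sum>c\<in>X. 180 * (Re c)\<^sup>2 * Re (1 / (of_real (1 + (- Re c)) - w * cnj (exp (\<i> * of_real (Im c))))))"
        by (intro sum_nonneg term0 w1)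
      show ?thesis
      proof (cases "cmod w < 1")
        case False
        then show ?thesis using w1 sn e by (simp add: ReH)
      next
        case True
        define \<omega> where "\<omega> = Ln w"
        have w0: "w \<noteq> 0" and "\<omega> \<in> triangle_union U" using log_not_in_core[of w] w True by (auto simp: \<omega>_def)
        then obtain c k where c: "c \<in> C" "dist (\<i> * of_real (Im c)) (\<omega> + 2 * of_real pi * \<i> * of_int k) \<le> 5 * (- Re c)"
          using C(4) by blast
        have we: "w = exp (\<omega> + 2 * of_real pi * \<i> * of_int k)"
          using w0 exp_integer_2pi[of "of_int k"] by (simp add: \<omega>_def exp_add mult_ac)
        have Re0: "Re \<omega> < 0" using True w0 by (simp add: \<omega>_def)
        have "\<bar>Re (\<i> * of_real (Im c) - (\<omega> + 2 * of_real pi * \<i> * of_int k))\<bar> \<le> 5 * (- Re c)"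
          using c(2) abs_Re_le_cmod order_trans unfolding dist_norm by blast
        then have dR: "- Re \<omega> \<le> 5 * (- Re c)" by simp
        have "- Re \<omega> \<le> Re (H w)"
        proof (cases "c \<in> X")
          case False
          then have "- Re \<omega> \<le> e" using dR c by (auto simp: X_def)
          then show ?thesis using sn by (simp add: ReH)
        next
          case cX: True
          have "cmod (exp (\<i> * of_real (Im c)) - w) \<le> 5 * (- Re c)"
            unfolding we using norm_exp_diff_le[of "\<i> * of_real (Im c)" "\<omega> + 2 * of_real pi * \<i> * of_int k"] Re0 c(2)
            by (simp add: dist_norm)
          then have "1 / (36 * (- Re c)) \<le> Re (1 / (of_real (1 + (- Re c)) - w * cnj (exp (\<i> * of_real (Im c)))))"
            by (intro Re_inverse_barrier_ge) (use Cneg c w1 in auto)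
          then have "180 * (Re c)\<^sup>2 * (1 / (36 * (- Re c))) \<le> 180 * (Re c)\<^sup>2 * Re (1 / (of_real (1 + (- Re c)) - w * cnj (exp (\<i> * of_real (Im c)))))"
            by (intro mult_left_mono) auto
          moreover have "180 * (Re c)\<^sup>2 * (1 / (36 * (- Re c))) = 5 * (- Re c)"
            using Cneg[OF c(1)] by (simp add: power2_eq_square field_simps)
          moreover have "180 * (Re c)\<^sup>2 * Re (1 / (of_real (1 + (- Re c)) - w * cnj (exp (\<i> * of_real (Im c)))))
             \<le> (\<Sum>c\<in>X. 180 * (Re c)\<^sup>2 * Re (1 / (of_real (1 + (- Re c)) - w * cnj (exp (\<i> * of_real (Im c))))))"
            by (rule member_le_sum[OF cX _ finX]) (use term0 w1 in auto)
          ultimately show ?thesis using dR e by (simp only: ReH)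
        qed
        then have "exp (- Re (H w)) \<le> exp (Re \<omega>)" by simp
        also have "\<dots> = cmod w" using w0 by (simp add: \<omega>_def)
        finally show ?thesis .
      qed
    qed
    have "ball 0 1 \<subseteq> (cball 0 1 :: complex set)" by auto
    moreover have "H holomorphic_on cball 0 1"
      unfolding H_def using nz by (intro holomorphic_intros) auto
    ultimately have H: "H holomorphic_on ball 0 1" "continuous_on (cball 0 1) H"
      by (auto intro: holomorphic_on_subset holomorphic_on_imp_continuous_on)
    have "core \<subseteq> ball 0 1" using core_subset U_sub by blast
    moreover have "0 \<in> core" by (simp add: core_def)
    ultimately obtain f where f: "f holomorphic_on ball 0 1" "f \<in> ball 0 1 \<rightarrow> core" "f 0 = 0"
        "exp (- Re (H 0) - e) \<le> cmod (deriv f 0)"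
      using Riemann_map_deriv_lower_bound[OF open_core starlike_imp_simply_connected[OF starlike_core] _ _ H bd e] by blast
    have "f \<in> ball 0 1 \<rightarrow> connected_component_set U 0" using f(2) core_subset_component by blast
    then have "cmod (deriv f 0) \<le> cmod (deriv \<phi> 0)" using covering_deriv_maximal[OF \<phi> f(1) _ f(3)] by blast
    moreover have "Re (H 0) \<le> e + 720 * m"
    proof -
      have "180 * (Re c)\<^sup>2 * Re (1 / (of_real (1 + (- Re c)) - 0 * cnj (exp (\<i> * of_real (Im c))))) \<le> 180 * (Re c)\<^sup>2" if "c \<in> X" for c
      proof -
        have "Re (1 / (of_real (1 + (- Re c)) - 0 * cnj (exp (\<i> * of_real (Im c))))) = 1 / (1 + (- Re c))"
          by (metis Re_complex_of_real diff_zero mult_zero_left of_real_1 of_real_divide)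
        also have "\<dots> \<le> 1" using Cneg[of c] that by (auto simp: X_def)
        finally show ?thesis by (metis mult_left_mono mult.right_neutral zero_le_mult_iff zero_le_numeral zero_le_power2)
      qed
      then have "Re (H 0) \<le> e + (\<Sum>c\<in>X. 180 * (Re c)\<^sup>2)" unfolding ReH by (intro add_left_mono sum_mono)
      also have "\<dots> \<le> e + 180 * (4 * m)" using sum_le[OF finX] by (auto simp: X_def sum_distrib_left[symmetric])
      finally show ?thesis by simp
    qed
    then have "exp (- 720 * m - \<epsilon>) \<le> exp (- Re (H 0) - e)" by (simp add: e_def)
    ultimately show ?thesis using f(4) by linarith
  qed
  then have "\<forall>\<^sub>F \<epsilon> in at_right 0. exp (- 720 * m - \<epsilon>) \<le> cmod (deriv \<phi> 0)"
    by (auto simp: eventually_at_right_field intro!: exI[of _ 1])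
  moreover have "((\<lambda>\<epsilon>. exp (- 720 * m - \<epsilon>)) \<longlongrightarrow> exp (- 720 * m - 0)) (at_right 0)"
    by (intro tendsto_intros)
  ultimately have "exp (- 720 * m - 0) \<le> cmod (deriv \<phi> 0)"
    by (intro tendsto_upperbound[of "\<lambda>\<epsilon>. exp (- 720 * m - \<epsilon>)" _ "at_right 0"]) auto
  then show ?thesis by (simp add: m_def)
qed

lemma mem_strip_translate:
  assumes "w \<in> obst"
  obtains v where "v \<in> obst" "v \<in> strip" "Re v = Re w"
proof -
  define k where "k = - \<lfloor>Im w / (2 * pi)\<rfloor>"
  define v where "v = w + 2 * of_real pi * \<i> * of_int k"
  have "- of_int k \<le> Im w / (2 * pi)" "Im w / (2 * pi) < - of_int k + 1"
    by (auto simp: k_def)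
  then have "- of_int k * (2 * pi) \<le> Im w" "Im w < (- of_int k + 1) * (2 * pi)"
    by (simp_all add: pos_le_divide_eq pos_divide_less_eq)
  then have "v \<in> strip" by (simp add: strip_def v_def algebra_simps)
  moreover have "v \<in> obst" unfolding v_def using assms by (rule obst_periodic)
  moreover have "Re v = Re w" by (simp add: v_def)
  ultimately show thesis using that by blast
qed

text \<open>The closed complement of \<open>U\<close> has a point nearest to 0; its logarithm,
  translated into the strip, is the deepest obstacle.\<close>

lemma deepest_obst:
  assumes "w \<in> obst"
  obtains v where "v \<in> obst" "v \<in> strip" "\<And>u. u \<in> obst \<Longrightarrow> Re v \<le> Re u"
proof -
  have "exp w \<in> - U" "closed (- U)" using assms open_U by (auto simp: obst_def)
  then obtain x where x: "x \<in> - U" "\<And>y. y \<in> - U \<Longrightarrow> dist 0 x \<le> dist 0 y"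
    using distance_attains_inf[of "- U" 0] by blast
  have "x \<noteq> 0" using x(1) zero_U by auto
  have "cmod x \<le> cmod (exp w)" using x(2)[OF \<open>exp w \<in> - U\<close>] by simp
  also have "\<dots> < 1" using assms by (simp add: obst_def)
  finally have "Ln x \<in> obst" using x(1) \<open>x \<noteq> 0\<close> by (simp add: obst_def)
  then obtain v where v: "v \<in> obst" "v \<in> strip" "Re v = Re (Ln x)" by (rule mem_strip_translate)
  have "Re v \<le> Re u" if "u \<in> obst" for u
  proof -
    have "cmod x \<le> cmod (exp u)" using x(2)[of "exp u"] that by (auto simp: obst_def)
    then have "ln (cmod x) \<le> Re u" using \<open>x \<noteq> 0\<close> by (simp add: ln_le_iff)
    then show ?thesis using v(3) \<open>x \<noteq> 0\<close> by simp
  qed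
  with v show thesis using that by blast
qed

section \<open>The upper bound, deep obstacles, and both cases combined\<close>

context
  fixes \<phi> :: "complex \<Rightarrow> complex"
  assumes cov: "disc_universal_covering (connected_component_set U 0) \<phi>" and \<phi>0: "\<phi> 0 = 0"
begin

lemma covering_properties:
  shows "\<phi> holomorphic_on ball 0 1" "\<And>z. cmod z < 1 \<Longrightarrow> \<phi> z \<in> U" "\<And>z. cmod z < 1 \<Longrightarrow> cmod (\<phi> z) < 1"
    "0 < cmod (deriv \<phi> 0)"
proof -
  show hol: "\<phi> holomorphic_on ball 0 1" using cov by (simp add: disc_universal_covering_def)
  have cs: "covering_space (ball 0 1) \<phi> (connected_component_set U 0)"
    using cov by (simp add: disc_universal_covering_def)
  show \<phi>U: "\<phi> z \<in> U" if "cmod z < 1" for z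
  proof -
    have "\<phi> z \<in> connected_component_set U 0"
      using cs that unfolding covering_space_def by (metis image_eqI mem_ball_0)
    then show ?thesis using connected_component_subset by blast
  qed
  show "cmod (\<phi> z) < 1" if "cmod z < 1" for z using \<phi>U[OF that] U_sub by auto
  show "0 < cmod (deriv \<phi> 0)" using covering_deriv_neq_0[OF cs open_ball hol, of 0] by simp
qed

lemma omits_obst: "cmod z < 1 \<Longrightarrow> w \<in> obst \<Longrightarrow> \<phi> z \<noteq> exp w"
  using covering_properties(2)[of z] by (auto simp: obst_def)

text \<open>Each finite part of the Vitali family has disjoint discs, so
  \<open>sum_disc_kernel_bound\<close> and the bound for omitted values limit its sum of squares by
  a multiple of \<open>l\<close>, uniformly; the covering turns this into a bound for the
  area.\<close>

lemma conformal_radius_upper_small: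
  assumes small: "\<And>w. w \<in> obst \<Longrightarrow> - 1 \<le> Re w"
  shows "ln (cmod (deriv \<phi> 0)) \<le> - measure lebesgue shadow / (75 * pi * (4 * 10^7))"
proof -
  define l where "l = - ln (cmod (deriv \<phi> 0))"
  obtain C where C: "countable C" "C \<subseteq> obst \<inter> strip"
    "pairwise (\<lambda>v w. disjnt (cball (\<i> * of_real (Im v)) (- Re v)) (cball (\<i> * of_real (Im w)) (- Re w))) C"
    "\<And>w. w \<in> shadow \<Longrightarrow> \<exists>c\<in>C. \<exists>k\<in>{-1,0,1::int}. dist (\<i> * of_real (Im c)) (w + 2 * of_real pi * \<i> * of_int k) \<le> 5 * (- Re c)"
    by (rule Vitali_obst[OF small]) iprover+
  have CX: "c \<in> obst" "- 1 \<le> Re c" "Re c < 0" "0 \<le> Im c" "Im c < 2 * pi" if "c \<in> C" for c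
    using C(2) that small[of c] obst_Re[of c] by (auto simp: strip_def)
  have fin: "(\<Sum>c\<in>X. (Re c)\<^sup>2) \<le> 4 * 10^7 * l" if X: "finite X" "X \<subseteq> C" for X
  proof -
    have inj: "inj_on exp X"
    proof (rule inj_onI)
      fix v w assume vw: "v \<in> X" "w \<in> X" "exp v = exp w"
      then have "v \<in> C" "w \<in> C" using X by auto
      then have "\<bar>Im v - Im w\<bar> < 2 * pi" using CX(4,5)[of v] CX(4,5)[of w] by linarith
      then show "v = w" using vw(3) by (rule exp_complex_eqI)
    qed
    have kb: "(\<Sum>p\<in>exp ` X. disc_kernel p z) \<le> 600" if "cmod z < 1" for z
      unfolding sum.reindex[OF inj] o_def
      by (rule sum_disc_kernel_bound[OF X(1) _ _ that])
         (use X CX C(3) in \<open>auto intro: pairwise_subset\<close>)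
    have "cmod (deriv \<phi> 0) \<le> exp (- (1 / 10^7) * (\<Sum>p\<in>exp ` X. (1 - (cmod p)\<^sup>2)\<^sup>2))"
      by (rule deriv_bound_omitted_values[OF covering_properties(1,3) \<phi>0 _ _ kb])
         (use X CX omits_obst in auto)
    then have "ln (cmod (deriv \<phi> 0)) \<le> - (1 / 10^7) * (\<Sum>p\<in>exp ` X. (1 - (cmod p)\<^sup>2)\<^sup>2)"
      using covering_properties(4) by (simp add: ln_le_iff)
    then have "(\<Sum>p\<in>exp ` X. (1 - (cmod p)\<^sup>2)\<^sup>2) \<le> 10^7 * l" by (simp add: l_def)
    \<comment> \<open>With \<open>d = - Re c\<close>,
      \<open>1 - |exp c|\<^sup>2 \<ge> 1 - exp (- d) \<ge> d / 2\<close>, which accounts for the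
      factor 4.\<close>
    moreover have "(\<Sum>c\<in>X. (Re c)\<^sup>2) / 4 \<le> (\<Sum>p\<in>exp ` X. (1 - (cmod p)\<^sup>2)\<^sup>2)"
      unfolding sum.reindex[OF inj] o_def sum_divide_distrib
    proof (rule sum_mono)
      fix c assume "c \<in> X"
      then have c: "- 1 \<le> Re c" "Re c < 0" using X CX by auto
      have "- Re c / 2 \<le> 1 - exp (Re c)" using one_minus_exp_minus_bounds(1)[of "- Re c"] c by simp
      also have "(exp (Re c))\<^sup>2 \<le> exp (Re c) * 1"
        unfolding power2_eq_square using c by (intro mult_left_mono) auto
      then have "1 - exp (Re c) \<le> 1 - (cmod (exp c))\<^sup>2" by simp
      finally have "(- Re c / 2)\<^sup>2 \<le> (1 - (cmod (exp c))\<^sup>2)\<^sup>2" using c by (intro power_mono) auto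
      then show "(Re c)\<^sup>2 / 4 \<le> (1 - (cmod (exp c))\<^sup>2)\<^sup>2" by (simp add: power_divide)
    qed
    ultimately show ?thesis by simp
  qed
  have "measure lebesgue shadow \<le> 75 * pi * (4 * 10^7 * l)"
    by (rule measure_shadow_le_sum[OF C(1,4) fin]) (use CX in \<open>auto simp: less_imp_le\<close>)
  then show ?thesis by (simp add: l_def field_simps)
qed

text \<open>Everything is comparable with the depth \<open>d = - Re v\<close>: the area lies between
  \<open>d / 4\<close> and \<open>2 \<pi> d\<close>, and the conformal radius between
  \<open>exp (- d)\<close> and \<open>exp (- d / 20)\<close>.\<close>

lemma conformal_radius_bounds_large:
  assumes v: "v \<in> obst" "v \<in> strip" "\<And>u. u \<in> obst \<Longrightarrow> Re v \<le> Re u" and v1: "Re v \<le> - 1"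
  shows "ln (cmod (deriv \<phi> 0)) \<le> - measure lebesgue shadow / (40 * pi)"
    "- 4 * measure lebesgue shadow \<le> ln (cmod (deriv \<phi> 0))"
proof -
  have "cmod (deriv \<phi> 0) \<le> exp (Re v / 20)"
    by (rule deriv_bound_single_omitted_value[OF covering_properties(1,3) \<phi>0 v1]) (use omits_obst v in auto)
  then have "ln (cmod (deriv \<phi> 0)) \<le> Re v / 20" using ln_le_iff[OF covering_properties(4)] by blast
  moreover have "measure lebesgue shadow \<le> 2 * pi * (- Re v)"
    by (rule measure_shadow_le) (use v v1 in auto)
  then have "Re v / 20 \<le> - measure lebesgue shadow / (40 * pi)" by (simp add: field_simps)
  ultimately show "ln (cmod (deriv \<phi> 0)) \<le> - measure lebesgue shadow / (40 * pi)" by linarith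
  \<comment> \<open>A competitor for \<open>covering_deriv_maximal\<close>: the dilation onto the
    disc of radius \<open>exp (Re v)\<close>, which lies in \<open>U\<close> because no obstacle is
    deeper than \<open>v\<close>.\<close>
  define f where "f = (\<lambda>z. of_real (exp (Re v)) * z :: complex)"
  have df: "deriv f 0 = of_real (exp (Re v))" unfolding f_def
    by (rule DERIV_imp_deriv) (auto intro!: derivative_eq_intros)
  have sub: "ball 0 (exp (Re v)) \<subseteq> U"
  proof
    fix x :: complex assume x: "x \<in> ball 0 (exp (Re v))"
    show "x \<in> U"
    proof (rule ccontr)
      assume "x \<notin> U"
      then have x0: "x \<noteq> 0" using zero_U by auto
      have "exp (Re v) < 1" using v1 by simp
      then have "cmod x < 1" using x by (simp del: exp_less_one_iff)
      then have "Ln x \<in> obst" using x0 \<open>x \<notin> U\<close> by (simp add: obst_def)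
      then have "Re v \<le> ln (cmod x)" using v(3) x0 by fastforce
      then have "exp (Re v) \<le> cmod x" using x0 by (simp add: ln_ge_iff)
      then show False using x by simp
    qed
  qed
  have "cmod (deriv f 0) \<le> cmod (deriv \<phi> 0)"
  proof (rule covering_deriv_maximal[OF cov \<phi>0])
    show "f holomorphic_on ball 0 1" unfolding f_def by (intro holomorphic_intros)
    have "ball 0 (exp (Re v)) \<subseteq> connected_component_set U 0"
      by (rule connected_component_maximal[OF _ _ sub]) auto
    moreover have "f z \<in> ball 0 (exp (Re v))" if "z \<in> ball 0 1" for z
      using that by (simp add: f_def norm_mult)
    ultimately show "f \<in> ball 0 1 \<rightarrow> connected_component_set U 0" by blast
  qed (simp add: f_def)
  then have "Re v \<le> ln (cmod (deriv \<phi> 0))"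
    using covering_properties(4) by (simp add: df ln_ge_iff)
  moreover have "- Re v / 4 \<le> measure lebesgue shadow"
  proof -
    obtain B where B: "B \<in> lmeasurable" "B \<subseteq> shadow" "measure lebesgue B = (1/2) * (- Re v) / 2"
      by (rule shadow_contains_box[OF v(1,2), of "1/2"]) (use v1 in auto)
    have "measure lebesgue B \<le> measure lebesgue shadow"
      by (rule measure_mono_fmeasurable[OF B(2)]) (use B(1) shadow_lmeasurable in auto)
    then show ?thesis using B(3) by simp
  qed
  ultimately show "- 4 * measure lebesgue shadow \<le> ln (cmod (deriv \<phi> 0))" by linarith
qed

lemma conformal_radius_bounds:
  shows "ln (cmod (deriv \<phi> 0)) \<le> - measure lebesgue shadow / (75 * pi * (4 * 10^7))"
    "- 720 * measure lebesgue shadow \<le> ln (cmod (deriv \<phi> 0))"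
proof -
  have m0: "0 \<le> measure lebesgue shadow" by simp
  have "ln (cmod (deriv \<phi> 0)) \<le> - measure lebesgue shadow / (75 * pi * (4 * 10^7)) \<and> 
      - 720 * measure lebesgue shadow \<le> ln (cmod (deriv \<phi> 0))"
  proof (cases "\<forall>w\<in>obst. - 1 \<le> Re w")
    case True
    then have "exp (- 720 * measure lebesgue shadow) \<le> cmod (deriv \<phi> 0)"
      by (intro conformal_radius_lower_small[OF _ cov \<phi>0]) auto
    then show ?thesis
      using conformal_radius_upper_small True covering_properties(4) by (simp add: ln_ge_iff)
  next
    case False
    then obtain w where w: "w \<in> obst" "Re w < - 1" by auto
    obtain v where v: "v \<in> obst" "v \<in> strip" "\<And>u. u \<in> obst \<Longrightarrow> Re v \<le> Re u"
      using deepest_obst[OF w(1)] by blast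
    then have "Re v \<le> - 1" using w by fastforce
    note b = conformal_radius_bounds_large[OF v this]
    have "measure lebesgue shadow / (75 * pi * (4 * 10^7)) \<le> measure lebesgue shadow / (40 * pi)"
      using m0 by (intro divide_left_mono) auto
    then show ?thesis using b m0 by simp
  qed
  then show "ln (cmod (deriv \<phi> 0)) \<le> - measure lebesgue shadow / (75 * pi * (4 * 10^7))"
    "- 720 * measure lebesgue shadow \<le> ln (cmod (deriv \<phi> 0))" by auto
qed

end

end

theorem proposition2:
  "\<exists>K K' :: real. 0 < K \<and> K < K' \<and>
     (\<forall>(U :: complex set) (r :: real) (a :: real).
        open U \<and> U \<subseteq> ball 0 1 \<and> 0 \<in> U \<and> has_conformal_radius U r \<and>
        a = 1 / (2 * pi) * cyl_area (cyl_proj ` triangle_union U) \<longrightarrow>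
        - K' * a \<le> ln r \<and> ln r \<le> - K * a)"
proof (intro exI conjI allI impI)
  \<comment> \<open>Both constants are those of \<open>conformal_radius_bounds\<close>, rewritten
    for the area \<open>2 \<pi> a\<close> of the shadow.\<close>
  show "(0::real) < 2 / (75 * (4 * 10^7))" by simp
  show "2 / (75 * (4 * 10^7)) < 1440 * pi" using pi_gt3 by simp
  fix U :: "complex set" and r a :: real
  assume asm: "open U \<and> U \<subseteq> ball 0 1 \<and> 0 \<in> U \<and> has_conformal_radius U r \<and>
        a = 1 / (2 * pi) * cyl_area (cyl_proj ` triangle_union U)"
  then interpret punctured_disc_region U by unfold_locales auto
  obtain \<phi> where \<phi>: "disc_universal_covering (connected_component_set U 0) \<phi>" "\<phi> 0 = 0" "r = cmod (deriv \<phi> 0)"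
    using asm by (auto simp: has_conformal_radius_def)
  have "2 * pi * a = measure lebesgue shadow" using asm cyl_area_eq by simp
  with conformal_radius_bounds[OF \<phi>(1,2)] \<phi>(3)
  have "ln r \<le> - (2 * pi * a) / (75 * pi * (4 * 10^7))" "- 720 * (2 * pi * a) \<le> ln r" by auto
  then show "- (1440 * pi) * a \<le> ln r" "ln r \<le> - (2 / (75 * (4 * 10^7))) * a" by simp_all
qed

end
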